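(* Let $X$ be an integral projective variety of dimension $n$. Let $L_1, L_2$ be line bundles on $X$ and let $S\subset X_{\mathrm{reg}}$ be a finite (reduced) set of cardinality $r$. Assume that $(X,L_1,S)$ satisfies condition $\dagger$ and that $S$ imposes independent conditions on $L_2$. Then $2S$ imposes independent conditions on $L_1\otimes L_2$, i.e. $$h^0(\mathcal{I}_{2S}\otimes L_1\otimes L_2)=h^0(L_1\otimes L_2)-(n+1)r,$$ so that $S$ does not belong to the $r$-th Terracini locus $\mathbb{T}_r(X,L_1\otimes L_2)$.
   Context: Work over an algebraically closed field of characteristic $0$. For a projective variety $X$ of dimension $n$, $X_{\mathrm{reg}}$ denotes its smooth locus. For $p\in X_{\mathrm{reg}}$ the double point $2p=(2p,X)$ is the closed subscheme of $X$ supported at $p$ and defined by the square of the maximal ideal of $p$; it has length $n+1$. For a finite reduced set $S\subset X_{\mathrm{reg}}$, $2S=(2S,X)=\bigcup_{p\in S}2p$. For a $0$-dimensional subscheme $Z\subset X$, $\mathcal{I}_Z=\mathcal{I}_{Z,X}$ is its ideal sheaf in $X$ and $\ell(Z)$ its length. A $0$-dimensional subscheme $Z\subset X$ imposes independent conditions on a line bundle $L$ if $h^0(\mathcal{I}_Z\otimes L)=h^0(L)-\ell(Z)$, equivalently, if the restriction map $H^0(L)\to H^0(L_{|Z})$ is surjective. Condition $\dagger$: for a finite reduced set $S\subset X_{\mathrm{reg}}$, $(X,L,S)$ satisfies condition $\dagger$ if for every $p\in S$ the scheme $S\cup 2p$ imposes independent conditions on $L$, i.e. $h^0(\mathcal{I}_{S\cup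 2p}\otimes L)=h^0(L)-\ell(S)-n$ for every $p\in S$. The $r$-th Terracini locus $\mathbb{T}_r(X,L)\subset X_{\mathrm{reg}}^{(r)}$ (a subset of the symmetric product) is the set of reduced finite sets $S\subset X_{\mathrm{reg}}$ of cardinality $r$ such that $h^0(\mathcal{I}_{2S}\otimes L)>h^0(L)-(n+1)r$. *)

theory Defs
  imports
    "HOL-Analysis.Analysis"
    "HOL-Computational_Algebra.Polynomial"
    "HOL-Library.Extended_Nat"
    "HOL-Library.Function_Algebras"
begin

section \<open>Dimensions of quotients of spaces of functions\<close>

definition fscale :: "'k::field \<Rightarrow> ('a \<Rightarrow> 'k) \<Rightarrow> 'a \<Rightarrow> 'k" where
  "fscale c f = (\<lambda>x. c * f x)"

interpretation fs: vector_space "fscale :: 'k::field \<Rightarrow> ('a \<Rightarrow> 'k) \<Rightarrow> 'a \<Rightarrow> 'k"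
  by unfold_locales (auto simp: fscale_def fun_eq_iff algebra_simps)

text \<open>The dimension of \<open>V / W\<close> for subspaces \<open>W \<subseteq> V\<close>: a finite subset of \<open>V\<close> is linearly independent
  modulo \<open>W\<close> (and maps injectively to \<open>V / W\<close>) iff it is independent and its span meets \<open>W\<close>
  trivially.\<close>

definition quot_dim :: "('a \<Rightarrow> 'k::field) set \<Rightarrow> ('a \<Rightarrow> 'k) set \<Rightarrow> enat" where
  "quot_dim V W =
    Sup {enat (card B) | B. finite B \<and> B \<subseteq> V \<and> fs.independent B \<and> fs.span B \<inter> W \<subseteq> {0}}"

section \<open>Projective varieties\<close>

text \<open>A point of projective space is the set of its homogeneous coordinate vectors; the projective
  space of vectors indexed by \<open>'n\<close> has dimension \<open>CARD('n) - 1\<close>.\<close>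

type_synonym ('k, 'n) ppoint = "('k ^ 'n) set"

definition proj_space :: "('k::field, 'n::finite) ppoint set" where
  "proj_space = {{c *s v | c. c \<noteq> 0} | v. v \<noteq> 0}"

text \<open>Homogeneous polynomials are identified with the functions they define, which is harmless over
  an infinite field.\<close>

definition forms :: "nat \<Rightarrow> ('k::field ^ 'n::finite \<Rightarrow> 'k) set" where
  "forms d = fs.span {(\<lambda>v. \<Prod>i\<in>UNIV. v $ i ^ \<alpha> i) | \<alpha>. (\<Sum>i\<in>UNIV. \<alpha> i) = d}"

definition zariski :: "('k::field, 'n::finite) ppoint topology" where
  "zariski = topology_generated_by
     {{p \<in> proj_space. \<forall>v\<in>p. F v \<noteq> 0} | F. \<exists>d. F \<in> forms d}"

definition irreducible_closed :: "'p topology \<Rightarrow> 'p set \<Rightarrow> bool" where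
  "irreducible_closed T Z \<longleftrightarrow> closedin T Z \<and> Z \<noteq> {} \<and>
     (\<forall>A B. closedin T A \<and> closedin T B \<and> Z \<subseteq> A \<union> B \<longrightarrow> Z \<subseteq> A \<or> Z \<subseteq> B)"

text \<open>Over an algebraically closed field, integral projective schemes are represented by their sets
  of closed points.\<close>

definition projective_variety :: "('k::field, 'n::finite) ppoint set \<Rightarrow> bool" where
  "projective_variety X \<longleftrightarrow> irreducible_closed zariski X"

abbreviation open_in :: "('k::field, 'n::finite) ppoint set \<Rightarrow> ('k, 'n) ppoint set \<Rightarrow> bool" where
  "open_in X U \<equiv> openin (subtopology zariski X) U"

definition krull_dim :: "'p topology \<Rightarrow> enat" where
  "krull_dim T = Sup {enat m | m. \<exists>C :: nat \<Rightarrow> 'p set.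
     (\<forall>i\<le>m. irreducible_closed T (C i)) \<and> (\<forall>i<m. C i \<subset> C (Suc i))}"

abbreviation var_dim :: "('k::field, 'n::finite) ppoint set \<Rightarrow> enat" where
  "var_dim X \<equiv> krull_dim (subtopology zariski X)"

section \<open>Regular functions and local rings\<close>

definition regular_on ::
  "('k::field, 'n::finite) ppoint set \<Rightarrow> ('k, 'n) ppoint set \<Rightarrow> (('k, 'n) ppoint \<Rightarrow> 'k) \<Rightarrow> bool" where
  "regular_on X U f \<longleftrightarrow> (\<forall>p\<in>U. \<exists>V d F G. open_in X V \<and> p \<in> V \<and> V \<subseteq> U \<and>
     F \<in> forms d \<and> G \<in> forms d \<and> (\<forall>q\<in>V. \<forall>v\<in>q. G v \<noteq> 0 \<and> f q = F v / G v))"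

definition germ_eq ::
  "('k::field, 'n::finite) ppoint set \<Rightarrow> ('k, 'n) ppoint \<Rightarrow> (('k, 'n) ppoint \<Rightarrow> 'k) \<Rightarrow>
    (('k, 'n) ppoint \<Rightarrow> 'k) \<Rightarrow> bool" where
  "germ_eq X p f g \<longleftrightarrow> (\<exists>U. open_in X U \<and> p \<in> U \<and> (\<forall>q\<in>U. f q = g q))"

text \<open>The local ring of \<open>X\<close> at \<open>p\<close> is the quotient of \<open>local_fun X p\<close> by \<open>germ_eq X p\<close>. The ideals
  of the local ring are represented by their preimages in \<open>local_fun X p\<close>; the quotient of the
  local ring by the ideal is then the quotient of \<open>local_fun X p\<close> by that preimage.\<close>

definition local_fun ::
  "('k::field, 'n::finite) ppoint set \<Rightarrow> ('k, 'n) ppoint \<Rightarrow> (('k, 'n) ppoint \<Rightarrow> 'k) set" where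
  "local_fun X p = {f. \<exists>U. open_in X U \<and> p \<in> U \<and> regular_on X U f}"

definition local_ideal ::
  "('k::field, 'n::finite) ppoint set \<Rightarrow> ('k, 'n) ppoint \<Rightarrow> (('k, 'n) ppoint \<Rightarrow> 'k) set \<Rightarrow> bool" where
  "local_ideal X p I \<longleftrightarrow> I \<subseteq> local_fun X p \<and> 0 \<in> I \<and> (\<forall>f\<in>I. \<forall>g\<in>I. f + g \<in> I) \<and>
     (\<forall>f\<in>I. \<forall>g\<in>local_fun X p. g * f \<in> I) \<and> (\<forall>f\<in>I. \<forall>g. germ_eq X p f g \<longrightarrow> g \<in> I)"

definition max_ideal ::
  "('k::field, 'n::finite) ppoint set \<Rightarrow> ('k, 'n) ppoint \<Rightarrow> (('k, 'n) ppoint \<Rightarrow> 'k) set" where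
  "max_ideal X p = {f \<in> local_fun X p. f p = 0}"

definition max_ideal_square ::
  "('k::field, 'n::finite) ppoint set \<Rightarrow> ('k, 'n) ppoint \<Rightarrow> (('k, 'n) ppoint \<Rightarrow> 'k) set" where
  "max_ideal_square X p = {f \<in> local_fun X p. \<exists>(m::nat) g h.
     (\<forall>j<m. g j \<in> max_ideal X p \<and> h j \<in> max_ideal X p) \<and>
     germ_eq X p f (\<Sum>j<m. g j * h j)}"

text \<open>Smoothness is regularity of the local ring, which is the same thing over an algebraically
  closed field.\<close>

definition reg_locus :: "('k::field, 'n::finite) ppoint set \<Rightarrow> ('k, 'n) ppoint set" where
  "reg_locus X = {p \<in> X. quot_dim (max_ideal X p) (max_ideal_square X p) = var_dim X}"

section \<open>Zero-dimensional subschemes\<close>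

text \<open>A subscheme with finite support is given by the stalks of its ideal sheaf.\<close>

type_synonym ('k, 'n) subscheme = "('k, 'n) ppoint \<Rightarrow> (('k, 'n) ppoint \<Rightarrow> 'k) set"

definition scheme_support ::
  "('k::field, 'n::finite) ppoint set \<Rightarrow> ('k, 'n) subscheme \<Rightarrow> ('k, 'n) ppoint set" where
  "scheme_support X Z = {p \<in> X. Z p \<noteq> local_fun X p}"

definition zero_dim_subscheme ::
  "('k::field, 'n::finite) ppoint set \<Rightarrow> ('k, 'n) subscheme \<Rightarrow> bool" where
  "zero_dim_subscheme X Z \<longleftrightarrow> (\<forall>p\<in>X. local_ideal X p (Z p)) \<and> finite (scheme_support X Z) \<and>
     (\<forall>p\<in>X. quot_dim (local_fun X p) (Z p) \<noteq> \<infinity>)"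

definition scheme_length ::
  "('k::field, 'n::finite) ppoint set \<Rightarrow> ('k, 'n) subscheme \<Rightarrow> enat" where
  "scheme_length X Z = (\<Sum>p\<in>scheme_support X Z. quot_dim (local_fun X p) (Z p))"

definition reduced_point ::
  "('k::field, 'n::finite) ppoint set \<Rightarrow> ('k, 'n) ppoint \<Rightarrow> ('k, 'n) subscheme" where
  "reduced_point X p = (\<lambda>q. if q = p then max_ideal X p else local_fun X q)"

definition double_point ::
  "('k::field, 'n::finite) ppoint set \<Rightarrow> ('k, 'n) ppoint \<Rightarrow> ('k, 'n) subscheme" where
  "double_point X p = (\<lambda>q. if q = p then max_ideal_square X p else local_fun X q)"

text \<open>Unions of subschemes correspond to intersections of ideals.\<close>

definition scheme_union ::
  "('k, 'n) subscheme \<Rightarrow> ('k, 'n) subscheme \<Rightarrow> ('k::field, 'n::finite) subscheme" where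
  "scheme_union Y Z = (\<lambda>q. Y q \<inter> Z q)"

definition scheme_Union ::
  "('k::field, 'n::finite) ppoint set \<Rightarrow> ('k, 'n) ppoint set \<Rightarrow>
    (('k, 'n) ppoint \<Rightarrow> ('k, 'n) subscheme) \<Rightarrow> ('k, 'n) subscheme" where
  "scheme_Union X S Z = (\<lambda>q. {f \<in> local_fun X q. \<forall>p\<in>S. f \<in> Z p q})"

definition reduced_points ::
  "('k::field, 'n::finite) ppoint set \<Rightarrow> ('k, 'n) ppoint set \<Rightarrow> ('k, 'n) subscheme" where
  "reduced_points X S = scheme_Union X S (reduced_point X)"

definition double_points ::
  "('k::field, 'n::finite) ppoint set \<Rightarrow> ('k, 'n) ppoint set \<Rightarrow> ('k, 'n) subscheme" where
  "double_points X S = scheme_Union X S (double_point X)"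

section \<open>Line bundles\<close>

text \<open>A line bundle is given by a trivialising open cover and its transition functions.\<close>

record ('k, 'n, 'i) lbundle =
  idx :: "'i set"
  patch :: "'i \<Rightarrow> ('k, 'n) ppoint set"
  trans_fun :: "'i \<Rightarrow> 'i \<Rightarrow> ('k, 'n) ppoint \<Rightarrow> 'k"

definition line_bundle ::
  "('k::field, 'n::finite) ppoint set \<Rightarrow> ('k, 'n, 'i) lbundle \<Rightarrow> bool" where
  "line_bundle X L \<longleftrightarrow>
     (\<forall>i\<in>idx L. open_in X (patch L i)) \<and> (\<Union>i\<in>idx L. patch L i) = X \<and>
     (\<forall>i\<in>idx L. \<forall>j\<in>idx L. regular_on X (patch L i \<inter> patch L j) (trans_fun L i j)) \<and>
     (\<forall>i\<in>idx L. \<forall>q\<in>patch L i. trans_fun L i i q = 1) \<and>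
     (\<forall>i\<in>idx L. \<forall>j\<in>idx L. \<forall>k\<in>idx L. \<forall>q\<in>patch L i \<inter> patch L j \<inter> patch L k.
        trans_fun L i j q * trans_fun L j k q = trans_fun L i k q)"

definition tensor ::
  "('k::field, 'n::finite, 'i) lbundle \<Rightarrow> ('k, 'n, 'j) lbundle \<Rightarrow> ('k, 'n, 'i \<times> 'j) lbundle" where
  "tensor L M = \<lparr>idx = idx L \<times> idx M,
     patch = (\<lambda>(i, j). patch L i \<inter> patch M j),
     trans_fun = (\<lambda>(i, j) (i', j') q. trans_fun L i i' q * trans_fun M j j' q)\<rparr>"

text \<open>A global section is the family \<open>curry s i\<close> of its local expressions, set to zero outside the
  patches so that the sections form a space of functions.\<close>

definition global_sections ::
  "('k::field, 'n::finite) ppoint set \<Rightarrow> ('k, 'n, 'i) lbundle \<Rightarrow> ('i \<times> ('k, 'n) ppoint \<Rightarrow> 'k) set" where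
  "global_sections X L = {s.
     (\<forall>i\<in>idx L. regular_on X (patch L i) (curry s i)) \<and>
     (\<forall>i\<in>idx L. \<forall>j\<in>idx L. \<forall>q\<in>patch L i \<inter> patch L j. s (i, q) = trans_fun L i j q * s (j, q)) \<and>
     (\<forall>i q. i \<notin> idx L \<or> q \<notin> patch L i \<longrightarrow> s (i, q) = 0)}"

definition ideal_sections ::
  "('k::field, 'n::finite) ppoint set \<Rightarrow> ('k, 'n) subscheme \<Rightarrow> ('k, 'n, 'i) lbundle \<Rightarrow>
    ('i \<times> ('k, 'n) ppoint \<Rightarrow> 'k) set" where
  "ideal_sections X Z L = {s \<in> global_sections X L.
     \<forall>p\<in>X. \<forall>i\<in>idx L. p \<in> patch L i \<longrightarrow> curry s i \<in> Z p}"

definition h0 :: "('k::field, 'n::finite) ppoint set \<Rightarrow> ('k, 'n, 'i) lbundle \<Rightarrow> enat" where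
  "h0 X L = quot_dim (global_sections X L) {0}"

definition h0_ideal ::
  "('k::field, 'n::finite) ppoint set \<Rightarrow> ('k, 'n) subscheme \<Rightarrow> ('k, 'n, 'i) lbundle \<Rightarrow> enat" where
  "h0_ideal X Z L = quot_dim (ideal_sections X Z L) {0}"

text \<open>Representatives of the elements of the stalk of \<open>L\<close> at \<open>p\<close>, in all trivialisations at \<open>p\<close>.\<close>

definition bundle_stalk ::
  "('k::field, 'n::finite) ppoint set \<Rightarrow> ('k, 'n, 'i) lbundle \<Rightarrow> ('k, 'n) ppoint \<Rightarrow>
    ('i \<times> ('k, 'n) ppoint \<Rightarrow> 'k) set" where
  "bundle_stalk X L p = {t.
     (\<forall>i\<in>idx L. p \<in> patch L i \<longrightarrow> curry t i \<in> local_fun X p) \<and>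
     (\<forall>i\<in>idx L. \<forall>j\<in>idx L. p \<in> patch L i \<inter> patch L j \<longrightarrow>
        germ_eq X p (curry t i) (trans_fun L i j * curry t j))}"

section \<open>Independent conditions and Terracini loci\<close>

text \<open>Surjectivity of the restriction of global sections of \<open>L\<close> to \<open>Z\<close>, the target being the direct
  sum over the support of \<open>Z\<close> of the stalks of \<open>L\<close> modulo the ideal of \<open>Z\<close>. The equivalence with
  the condition on dimensions, given that \<open>h0 X L\<close> is finite (as it is for projective \<open>X\<close>), is
  \<open>independent_conditions_iff_h0\<close> below.\<close>

definition independent_conditions ::
  "('k::field, 'n::finite) ppoint set \<Rightarrow> ('k, 'n) subscheme \<Rightarrow> ('k, 'n, 'i) lbundle \<Rightarrow> bool" where
  "independent_conditions X Z L \<longleftrightarrow>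
     (\<forall>t. (\<forall>p\<in>scheme_support X Z. t p \<in> bundle_stalk X L p) \<longrightarrow>
       (\<exists>s\<in>global_sections X L. \<forall>p\<in>scheme_support X Z. \<forall>i\<in>idx L. p \<in> patch L i \<longrightarrow>
          curry s i - curry (t p) i \<in> Z p))"

definition dagger ::
  "('k::field, 'n::finite) ppoint set \<Rightarrow> ('k, 'n, 'i) lbundle \<Rightarrow> ('k, 'n) ppoint set \<Rightarrow> bool" where
  "dagger X L S \<longleftrightarrow>
     (\<forall>p\<in>S. independent_conditions X (scheme_union (reduced_points X S) (double_point X p)) L)"

definition terracini_locus ::
  "nat \<Rightarrow> ('k::field, 'n::finite) ppoint set \<Rightarrow> ('k, 'n, 'i) lbundle \<Rightarrow> ('k, 'n) ppoint set set" where
  "terracini_locus r X L = {S. S \<subseteq> reg_locus X \<and> finite S \<and> card S = r \<and>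
     h0_ideal X (double_points X S) L + (var_dim X + 1) * enat r > h0 X L}"

section \<open>The dimension criterion for independent conditions\<close>

subsection \<open>Dimensions of quotients\<close>

definition indep_mod :: "('a \<Rightarrow> 'k::field) set \<Rightarrow> ('a \<Rightarrow> 'k) set \<Rightarrow> bool" where
  "indep_mod W B \<longleftrightarrow> finite B \<and> fs.independent B \<and> fs.span B \<inter> W \<subseteq> {0}"

lemma quot_dim_altdef: "quot_dim V W = Sup {enat (card B) | B. B \<subseteq> V \<and> indep_mod W B}"
  unfolding quot_dim_def indep_mod_def by (rule arg_cong[where f = Sup]) auto

lemma quot_dim_ge: "B \<subseteq> V \<Longrightarrow> indep_mod W B \<Longrightarrow> enat (card B) \<le> quot_dim V W"
  unfolding quot_dim_altdef by (rule Sup_upper) auto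

lemma quot_dim_le:
  assumes "\<And>B. B \<subseteq> V \<Longrightarrow> indep_mod W B \<Longrightarrow> enat (card B) \<le> m"
  shows "quot_dim V W \<le> m"
  unfolding quot_dim_altdef by (rule Sup_least) (use assms in auto)

lemma indep_mod_sum:
  assumes "indep_mod W B" "(\<Sum>b\<in>B. fscale (u b) b) \<in> W" "b \<in> B"
  shows "u b = 0"
proof -
  have "(\<Sum>b\<in>B. fscale (u b) b) \<in> fs.span B"
    by (intro fs.span_sum fs.span_scale fs.span_base)
  hence "(\<Sum>b\<in>B. fscale (u b) b) = 0" using assms by (auto simp: indep_mod_def)
  thus ?thesis using assms fs.dependent_finite unfolding indep_mod_def by blast
qed

lemma indep_modI:
  assumes "finite B" "0 \<in> W"
    and "\<And>u. (\<Sum>b\<in>B. fscale (u b) b) \<in> W \<Longrightarrow> \<forall>b\<in>B. u b = 0"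
  shows "indep_mod W B"
  unfolding indep_mod_def
proof (intro conjI assms(1))
  show "fs.independent B"
    using fs.dependent_finite[OF assms(1)] assms(2,3) by metis
  show "fs.span B \<inter> W \<subseteq> {0}"
  proof
    fix x assume x: "x \<in> fs.span B \<inter> W"
    then obtain u where u: "x = (\<Sum>b\<in>B. fscale (u b) b)"
      using fs.span_finite[OF assms(1)] by auto
    with x assms(3)[of u] have "x = (\<Sum>b\<in>B. fscale 0 b)" by (auto intro!: sum.cong)
    thus "x \<in> {0}" by simp
  qed
qed

lemma dependent_family:
  fixes x :: "'e \<Rightarrow> 'a \<Rightarrow> 'k::field"
  assumes "finite E" "finite B" "card B < card E" "\<And>e. e \<in> E \<Longrightarrow> x e \<in> fs.span B"
  shows "\<exists>u. (\<Sum>e\<in>E. fscale (u e) (x e)) = 0 \<and> (\<exists>e\<in>E. u e \<noteq> 0)"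
proof (cases "inj_on x E")
  case True
  have "fs.dependent (x ` E)"
    using fs.independent_span_bound[OF assms(2), of "x ` E"] assms card_image[OF True] by fastforce
  then obtain u where u: "\<exists>v\<in>x ` E. u v \<noteq> 0" "(\<Sum>v\<in>x ` E. fscale (u v) v) = 0"
    using fs.dependent_finite[of "x ` E"] assms(1) by auto
  have "(\<Sum>e\<in>E. fscale (u (x e)) (x e)) = 0" using u(2) by (simp add: sum.reindex[OF True])
  with u(1) show ?thesis by (intro exI[of _ "u \<circ> x"]) auto
next
  case False
  then obtain a b where ab: "a \<in> E" "b \<in> E" "a \<noteq> b" "x a = x b" by (auto simp: inj_on_def)
  define u where "u e = (if e = a then 1 else if e = b then -1 else (0::'k))" for e
  have "(\<Sum>e\<in>E. fscale (u e) (x e)) = (\<Sum>e\<in>{a,b}. fscale (u e) (x e))"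
    by (rule sum.mono_neutral_right) (use ab assms(1) in \<open>auto simp: u_def\<close>)
  also have "\<dots> = 0" using ab by (simp add: u_def)
  finally show ?thesis using ab by (intro exI[of _ u]) (auto simp: u_def)
qed

lemma indep_mod_empty: "indep_mod W {}"
  by (simp add: indep_mod_def fs.independent_empty)

lemma quot_dim_le_card:
  assumes "fs.subspace W" "finite B" "V \<subseteq> fs.span (B \<union> W)"
  shows "quot_dim V W \<le> enat (card B)"
proof (rule quot_dim_le)
  fix E assume E: "E \<subseteq> V" "indep_mod W E"
  have "\<forall>e\<in>E. \<exists>x\<in>fs.span B. \<exists>a\<in>W. e = x + a"
  proof
    fix e assume "e \<in> E"
    hence "e \<in> fs.span (B \<union> W)" using E assms by auto
    thus "\<exists>x\<in>fs.span B. \<exists>a\<in>W. e = x + a"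
      unfolding fs.span_Un using assms(1) fs.span_eq_iff by blast
  qed
  then obtain x a where xa: "\<And>e. e \<in> E \<Longrightarrow> x e \<in> fs.span B \<and> a e \<in> W \<and> e = x e + a e" by metis
  show "enat (card E) \<le> enat (card B)"
  proof (rule ccontr)
    assume "\<not> ?thesis"
    then obtain u where u: "(\<Sum>e\<in>E. fscale (u e) (x e)) = 0" "\<exists>e\<in>E. u e \<noteq> 0"
      using dependent_family[of E B x] E assms(2) xa by (auto simp: indep_mod_def)
    have "(\<Sum>e\<in>E. fscale (u e) e) = (\<Sum>e\<in>E. fscale (u e) (x e) + fscale (u e) (a e))"
      by (rule sum.cong) (use xa fs.scale_right_distrib in metis)+
    also have "\<dots> = (\<Sum>e\<in>E. fscale (u e) (a e))" using u(1) by (simp add: sum.distrib)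
    also have "\<dots> \<in> W" using xa assms(1) by (intro fs.subspace_sum fs.subspace_scale) auto
    finally show False using indep_mod_sum[OF E(2)] u(2) by blast
  qed
qed

lemma Sup_enat_attained:
  assumes "Sup A = enat m" "A \<noteq> {}"
  shows "enat m \<in> A"
proof -
  have "y \<le> enat m" if "y \<in> A" for y
    using Sup_upper[OF that] assms(1) by simp
  hence "finite A" by (rule finite_enat_bounded)
  thus ?thesis using assms Max_in[OF \<open>finite A\<close> assms(2)] by (simp add: Sup_enat_def)
qed

lemma quot_dim_basis:
  assumes "quot_dim V W = enat m" "fs.subspace W"
  obtains B where "B \<subseteq> V" "indep_mod W B" "card B = m" "V \<subseteq> fs.span (B \<union> W)"
proof -
  have "{} \<subseteq> V \<and> indep_mod W {}" by (simp add: indep_mod_empty)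
  hence "{enat (card B) | B. B \<subseteq> V \<and> indep_mod W B} \<noteq> {}" by blast
  from Sup_enat_attained[OF _ this, of m] obtain B where
    B: "B \<subseteq> V" "indep_mod W B" "card B = m" using assms(1) by (auto simp: quot_dim_altdef)
  have "V \<subseteq> fs.span (B \<union> W)"
  proof (rule ccontr)
    assume "\<not> ?thesis"
    then obtain v where v: "v \<in> V" "v \<notin> fs.span (B \<union> W)" by blast
    have fin: "finite B" using B by (simp add: indep_mod_def)
    have vB: "v \<notin> B" using v fs.span_base by blast
    have "indep_mod W (insert v B)"
    proof (rule indep_modI)
      show "finite (insert v B)" "0 \<in> W" using fin assms(2) fs.subspace_0 by auto
      fix u assume *: "(\<Sum>b\<in>insert v B. fscale (u b) b) \<in> W"
      have s: "(\<Sum>b\<in>insert v B. fscale (u b) b) = fscale (u v) v + (\<Sum>b\<in>B. fscale (u b) b)"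
        using fin vB by simp
      have inB: "(\<Sum>b\<in>B. fscale (u b) b) \<in> fs.span (B \<union> W)"
        by (intro fs.span_sum fs.span_scale fs.span_base) auto
      have "fscale (u v) v = (\<Sum>b\<in>insert v B. fscale (u b) b) - (\<Sum>b\<in>B. fscale (u b) b)"
        using s by simp
      also have "\<dots> \<in> fs.span (B \<union> W)"
        using * inB by (intro fs.span_diff) (auto intro: fs.span_base)
      finally have "fscale (inverse (u v)) (fscale (u v) v) \<in> fs.span (B \<union> W)"
        by (rule fs.span_scale)
      hence uv: "u v = 0" using v by (cases "u v = 0") (auto simp: fs.scale_scale)
      hence "(\<Sum>b\<in>B. fscale (u b) b) \<in> W" using * s by simp
      thus "\<forall>b\<in>insert v B. u b = 0" using uv indep_mod_sum[OF B(2)] by blast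
    qed
    hence "enat (card (insert v B)) \<le> enat m"
      using quot_dim_ge[of "insert v B" V W] v B assms(1) by auto
    thus False using fin vB B by simp
  qed
  thus ?thesis using B that by blast
qed

lemma enat_le_iff_nat_le: "(\<And>k. enat k \<le> x \<Longrightarrow> enat k \<le> y) \<Longrightarrow> x \<le> (y::enat)"
proof (cases y)
  case (enat m)
  moreover assume *: "\<And>k. enat k \<le> x \<Longrightarrow> enat k \<le> y"
  ultimately have "\<not> enat (Suc m) \<le> x" by fastforce
  thus ?thesis using enat by (metis Suc_ile_eq leI)
qed simp

lemma quot_dim_witness:
  assumes "enat k \<le> quot_dim V W"
  shows "\<exists>B\<subseteq>V. indep_mod W B \<and> k \<le> card B"
proof (rule ccontr)
  assume *: "\<not> ?thesis"
  have "quot_dim V W \<le> enat (k - 1)"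
  proof (rule quot_dim_le)
    fix B assume "B \<subseteq> V" "indep_mod W B"
    hence "\<not> k \<le> card B" using * by blast
    thus "enat (card B) \<le> enat (k - 1)" by simp
  qed
  moreover have "k \<noteq> 0"
  proof
    assume "k = 0"
    moreover have "{} \<subseteq> V \<and> indep_mod W {}" by (simp add: indep_mod_empty)
    ultimately show False using * by blast
  qed
  moreover have "enat k \<le> enat (k - 1)" using assms calculation(1) by (rule order.trans)
  ultimately show False by simp
qed

lemma quot_dim_add_le:
  assumes "fs.subspace A" "fs.subspace B" "A \<subseteq> B" "B \<subseteq> C" "fs.subspace C"
  shows "quot_dim B A + quot_dim C B \<le> quot_dim C A"
proof -
  have *: "enat (k + l) \<le> quot_dim C A" if k: "enat k \<le> quot_dim B A" and l: "enat l \<le> quot_dim C B" for k l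
  proof -
    obtain E where E: "E \<subseteq> B" "indep_mod A E" "k \<le> card E"
      using quot_dim_witness[OF k] by blast
    obtain F where F: "F \<subseteq> C" "indep_mod B F" "l \<le> card F"
      using quot_dim_witness[OF l] by blast
    have fin: "finite E" "finite F" using E F by (auto simp: indep_mod_def)
    have disj: "E \<inter> F = {}"
    proof (rule ccontr)
      assume "\<not> ?thesis"
      then obtain x where "x \<in> E" "x \<in> F" by blast
      hence "x = 0" using F(2) E(1) fs.span_base unfolding indep_mod_def by blast
      thus False using \<open>x \<in> F\<close> F(2) fs.dependent_zero unfolding indep_mod_def by blast
    qed
    have "indep_mod A (E \<union> F)"
    proof (rule indep_modI)
      show "finite (E \<union> F)" "0 \<in> A" using fin assms fs.subspace_0 by auto
      fix u assume u: "(\<Sum>b\<in>E \<union> F. fscale (u b) b) \<in> A"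
      have s: "(\<Sum>b\<in>E \<union> F. fscale (u b) b) = (\<Sum>b\<in>E. fscale (u b) b) + (\<Sum>b\<in>F. fscale (u b) b)"
        using fin disj by (simp add: sum.union_disjoint)
      have "(\<Sum>b\<in>E. fscale (u b) b) \<in> B"
        using E assms(2) by (intro fs.subspace_sum fs.subspace_scale) auto
      hence "(\<Sum>b\<in>E \<union> F. fscale (u b) b) - (\<Sum>b\<in>E. fscale (u b) b) \<in> B"
        using u assms by (intro fs.subspace_diff) auto
      hence "(\<Sum>b\<in>F. fscale (u b) b) \<in> B" using s by simp
      hence F0: "\<forall>b\<in>F. u b = 0" using indep_mod_sum[OF F(2)] by blast
      hence "(\<Sum>b\<in>F. fscale (u b) b) = 0" by (intro sum.neutral) auto
      hence "(\<Sum>b\<in>E. fscale (u b) b) \<in> A" using u s by simp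
      hence "\<forall>b\<in>E. u b = 0" using indep_mod_sum[OF E(2)] by blast
      with F0 show "\<forall>b\<in>E \<union> F. u b = 0" by blast
    qed
    hence "enat (card (E \<union> F)) \<le> quot_dim C A"
      using E F assms by (intro quot_dim_ge) auto
    moreover have "k + l \<le> card (E \<union> F)" using E F fin disj by (simp add: card_Un_disjoint)
    ultimately show ?thesis by (meson enat_ord_simps(1) order.trans)
  qed
  have le: "enat k \<le> quot_dim C A" if "enat k \<le> quot_dim B A \<or> enat k \<le> quot_dim C B" for k
    using *[of k 0] *[of 0 k] that by (auto simp flip: zero_enat_def)
  show ?thesis
  proof (cases "quot_dim B A = \<infinity> \<or> quot_dim C B = \<infinity>")
    case True
    have "\<infinity> \<le> quot_dim C A"
      by (rule enat_le_iff_nat_le) (use True le in auto)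
    thus ?thesis by simp
  next
    case False
    then obtain a b where "quot_dim B A = enat a" "quot_dim C B = enat b" by auto
    thus ?thesis using *[of a b] by simp
  qed
qed

lemma quot_dim_add:
  assumes "fs.subspace A" "fs.subspace B" "A \<subseteq> B" "B \<subseteq> C" "fs.subspace C"
  shows "quot_dim C A = quot_dim B A + quot_dim C B"
proof (cases "quot_dim B A = \<infinity> \<or> quot_dim C B = \<infinity>")
  case True
  thus ?thesis using quot_dim_add_le[OF assms] by auto
next
  case False
  then obtain m l where ml: "quot_dim B A = enat m" "quot_dim C B = enat l" by auto
  obtain E where E: "E \<subseteq> B" "indep_mod A E" "card E = m" "B \<subseteq> fs.span (E \<union> A)"
    using quot_dim_basis[OF ml(1) assms(1)] .
  obtain F where F: "F \<subseteq> C" "indep_mod B F" "card F = l" "C \<subseteq> fs.span (F \<union> B)"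
    using quot_dim_basis[OF ml(2) assms(2)] .
  have "F \<union> B \<subseteq> fs.span ((F \<union> E) \<union> A)"
  proof -
    have "fs.span (E \<union> A) \<subseteq> fs.span ((F \<union> E) \<union> A)" by (rule fs.span_mono) auto
    thus ?thesis using E(4) fs.span_superset[of "(F \<union> E) \<union> A"] by blast
  qed
  hence "C \<subseteq> fs.span ((F \<union> E) \<union> A)"
    using F(4) fs.span_minimal fs.subspace_span by blast
  moreover have "finite (F \<union> E)" using E F by (auto simp: indep_mod_def)
  ultimately have "quot_dim C A \<le> enat (card (F \<union> E))"
    using quot_dim_le_card[OF assms(1)] by blast
  also have "\<dots> \<le> enat (m + l)" using card_Un_le[of F E] E F by simp
  finally show ?thesis using quot_dim_add_le[OF assms] ml by (simp add: order.antisym)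
qed

lemma quot_dim_eq_0:
  assumes "fs.subspace U" "U \<subseteq> V"
  shows "quot_dim V U = 0 \<longleftrightarrow> V = U"
proof
  assume "quot_dim V U = 0"
  then obtain B where "card B = 0" "indep_mod U B" "V \<subseteq> fs.span (B \<union> U)"
    using quot_dim_basis[of V U 0] assms by (metis zero_enat_def)
  hence "V \<subseteq> fs.span U" by (auto simp: indep_mod_def)
  thus "V = U" using assms fs.span_eq_iff by blast
next
  assume "V = U"
  hence "V \<subseteq> fs.span ({} \<union> U)" using fs.span_superset by auto
  from quot_dim_le_card[OF assms(1) _ this] have "quot_dim V U \<le> enat 0" by simp
  thus "quot_dim V U = 0" by (simp add: zero_enat_def[symmetric])
qed

lemma quot_dim_image:
  fixes \<phi> :: "('a \<Rightarrow> 'k::field) \<Rightarrow> ('b \<Rightarrow> 'k)"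
  assumes lin: "\<And>f g. \<phi> (f + g) = \<phi> f + \<phi> g" "\<And>c f. \<phi> (fscale c f) = fscale c (\<phi> f)"
    and sub: "fs.subspace V" "fs.subspace T" "fs.subspace U"
    and "\<phi> ` V \<subseteq> U" "T \<subseteq> U" "\<And>x. x \<in> U \<Longrightarrow> \<exists>v\<in>V. \<exists>t\<in>T. x = \<phi> v + t"
  shows "quot_dim V {v \<in> V. \<phi> v \<in> T} = quot_dim U T"
proof -
  interpret \<phi>: Vector_Spaces.linear fscale fscale \<phi>
    by unfold_locales (use lin in auto)
  let ?W = "{v \<in> V. \<phi> v \<in> T}"
  have subW: "fs.subspace ?W"
    using sub lin \<phi>.zero unfolding fs.subspace_def by auto
  have *: "indep_mod T (\<phi> ` E) \<and> card (\<phi> ` E) = card E" if E: "E \<subseteq> V" "indep_mod ?W E" for E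
  proof -
    have fin: "finite E" using E by (simp add: indep_mod_def)
    have key: "\<forall>e\<in>E. u e = 0" if "(\<Sum>e\<in>E. fscale (u e) (\<phi> e)) \<in> T" for u
    proof -
      have "\<phi> (\<Sum>e\<in>E. fscale (u e) e) \<in> T" using that by (simp add: \<phi>.sum lin)
      moreover have "(\<Sum>e\<in>E. fscale (u e) e) \<in> V"
        using E sub by (intro fs.subspace_sum fs.subspace_scale) auto
      ultimately show ?thesis using indep_mod_sum[OF E(2)] by blast
    qed
    have inj: "inj_on \<phi> E"
    proof (rule inj_onI, rule ccontr)
      fix a b assume ab: "a \<in> E" "b \<in> E" "\<phi> a = \<phi> b" "a \<noteq> b"
      define u where "u e = (if e = a then 1 else if e = b then -1 else (0::'k))" for e
      have "(\<Sum>e\<in>E. fscale (u e) (\<phi> e)) = (\<Sum>e\<in>{a,b}. fscale (u e) (\<phi> e))"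
        by (rule sum.mono_neutral_right) (use ab fin in \<open>auto simp: u_def\<close>)
      also have "\<dots> = 0" using ab by (simp add: u_def)
      finally have "u a = 0" using key[of u] ab sub fs.subspace_0 by metis
      thus False by (simp add: u_def)
    qed
    have "indep_mod T (\<phi> ` E)"
    proof (rule indep_modI)
      show "finite (\<phi> ` E)" "0 \<in> T" using fin sub fs.subspace_0 by auto
      fix u assume "(\<Sum>b\<in>\<phi> ` E. fscale (u b) b) \<in> T"
      hence "(\<Sum>e\<in>E. fscale (u (\<phi> e)) (\<phi> e)) \<in> T" by (simp add: sum.reindex[OF inj])
      from key[OF this] show "\<forall>b\<in>\<phi> ` E. u b = 0" by blast
    qed
    thus ?thesis using card_image[OF inj] by blast
  qed
  have le: "quot_dim V ?W \<le> quot_dim U T"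
  proof (rule quot_dim_le)
    fix E assume E: "E \<subseteq> V" "indep_mod ?W E"
    have "\<phi> ` E \<subseteq> U" using E assms by blast
    thus "enat (card E) \<le> quot_dim U T" using *[OF E] quot_dim_ge[of "\<phi> ` E" U T] by simp
  qed
  show ?thesis
  proof (cases "quot_dim V ?W")
    case infinity
    thus ?thesis using le by simp
  next
    case (enat m)
    obtain E where E: "E \<subseteq> V" "indep_mod ?W E" "card E = m" "V \<subseteq> fs.span (E \<union> ?W)"
      using quot_dim_basis[OF enat subW] .
    have "U \<subseteq> fs.span (\<phi> ` E \<union> T)"
    proof
      fix x assume "x \<in> U"
      then obtain v t where vt: "v \<in> V" "t \<in> T" "x = \<phi> v + t" using assms by blast
      have "v \<in> fs.span (E \<union> ?W)" using vt E by blast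
      then obtain a b where ab: "a \<in> fs.span E" "b \<in> ?W" "v = a + b"
        unfolding fs.span_Un using subW fs.span_eq_iff by blast
      have "\<phi> a \<in> fs.span (\<phi> ` E)" using ab(1) \<phi>.span_image by blast
      hence "\<phi> a \<in> fs.span (\<phi> ` E \<union> T)" using fs.span_mono[of "\<phi> ` E" "\<phi> ` E \<union> T"] by blast
      moreover have "\<phi> b \<in> fs.span (\<phi> ` E \<union> T)" "t \<in> fs.span (\<phi> ` E \<union> T)"
        using ab vt by (auto intro: fs.span_base)
      ultimately show "x \<in> fs.span (\<phi> ` E \<union> T)"
        using vt ab lin by (auto intro: fs.span_add)
    qed
    hence "quot_dim U T \<le> enat (card (\<phi> ` E))"
      using E sub by (intro quot_dim_le_card) (auto simp: indep_mod_def)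
    also have "\<dots> = quot_dim V ?W" using *[OF E(1,2)] E enat by simp
    finally show ?thesis using le by simp
  qed
qed

subsection \<open>Local rings and sections\<close>

lemma forms_subspace: "fs.subspace (forms d)"
  by (simp add: forms_def fs.subspace_span)

lemma forms_mult:
  assumes "F \<in> forms d" "G \<in> forms e"
  shows "F * G \<in> forms (d + e)"
proof -
  let ?m = "\<lambda>(\<alpha>::'b \<Rightarrow> nat) v. \<Prod>i\<in>UNIV. (v::'a^'b) $ i ^ \<alpha> i"
  have mono: "?m \<alpha> * ?m \<beta> \<in> forms (d + e)"
    if "(\<Sum>i\<in>UNIV. \<alpha> i) = d" "(\<Sum>i\<in>UNIV. \<beta> i) = e" for \<alpha> \<beta>
    unfolding forms_def
    by (rule fs.span_base)
       (use that in \<open>auto simp: fun_eq_iff power_add prod.distrib sum.distrib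
          intro!: exI[of _ "\<lambda>i. \<alpha> i + \<beta> i"]\<close>)
  have scale: "F * fscale c G = fscale c (F * G)" "fscale c F * G = fscale c (F * G)"
    for c and F G :: "'a^'b \<Rightarrow> 'a"
    by (auto simp: fscale_def fun_eq_iff)
  have 1: "?m \<alpha> * G \<in> forms (d + e)" if \<alpha>: "(\<Sum>i\<in>UNIV. \<alpha> i) = d" for \<alpha>
    using assms(2) unfolding forms_def[of e]
  proof (induction rule: fs.span_induct_alt)
    case base
    show ?case unfolding mult_zero_right mult_zero_left by (rule fs.subspace_0[OF forms_subspace])
  next
    case (step c x y)
    have "?m \<alpha> * x \<in> forms (d + e)" using step(1) mono[OF \<alpha>] by auto
    from fs.subspace_add[OF forms_subspace fs.subspace_scale[OF forms_subspace this, of c] step(2)]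
    show ?case by (simp only: distrib_left scale)
  qed
  show ?thesis
    using assms(1) unfolding forms_def[of d]
  proof (induction rule: fs.span_induct_alt)
    case base
    show ?case unfolding mult_zero_right mult_zero_left by (rule fs.subspace_0[OF forms_subspace])
  next
    case (step c x y)
    have "x * G \<in> forms (d + e)" using step(1) 1 by auto
    from fs.subspace_add[OF forms_subspace fs.subspace_scale[OF forms_subspace this, of c] step(2)]
    show ?case by (simp only: distrib_right scale)
  qed
qed

lemma forms_const: "(\<lambda>_. c) \<in> forms 0"
proof -
  have "(\<lambda>v::'a^'b. \<Prod>i\<in>UNIV. v $ i ^ 0) \<in> forms 0"
    unfolding forms_def by (rule fs.span_base) (intro CollectI exI[of _ "\<lambda>_. 0"], simp)
  from fs.subspace_scale[OF forms_subspace this, of c] show ?thesis by (simp add: fscale_def)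
qed

lemma regular_onE:
  assumes "regular_on X U f" "p \<in> U"
  obtains V d F G where "open_in X V" "p \<in> V" "V \<subseteq> U" "F \<in> forms d" "G \<in> forms d"
    "\<forall>q\<in>V. \<forall>v\<in>q. G v \<noteq> 0 \<and> f q = F v / G v"
  using bspec[OF assms(1)[unfolded regular_on_def] assms(2)] by (elim exE conjE) (rule that)

lemma regular_on_subset:
  assumes "regular_on X U f" "open_in X V" "V \<subseteq> U"
  shows "regular_on X V f"
  unfolding regular_on_def
proof
  fix p assume "p \<in> V"
  with assms(3) have "p \<in> U" by blast
  from regular_onE[OF assms(1) this] obtain W d F G where
    "open_in X W" "p \<in> W" "F \<in> forms d" "G \<in> forms d"
    "\<forall>q\<in>W. \<forall>v\<in>q. G v \<noteq> 0 \<and> f q = F v / G v"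
    by metis
  thus "\<exists>W d F G. open_in X W \<and> p \<in> W \<and> W \<subseteq> V \<and> F \<in> forms d \<and> G \<in> forms d \<and>
      (\<forall>q\<in>W. \<forall>v\<in>q. G v \<noteq> 0 \<and> f q = F v / G v)"
    using assms \<open>p \<in> V\<close>
    by (intro exI[of _ "W \<inter> V"] exI[of _ d] exI[of _ F] exI[of _ G]) (auto intro: openin_Int)
qed

lemma regular_on_combine:
  fixes X :: "('k::field, 'n::finite) ppoint set"
  assumes f: "regular_on X U f" and g: "regular_on X U g"
    and H: "\<And>d e F G F' (G' :: 'k ^ 'n \<Rightarrow> 'k). F \<in> forms d \<Longrightarrow> G \<in> forms d \<Longrightarrow> F' \<in> forms e \<Longrightarrow> G' \<in> forms e \<Longrightarrow>
      \<exists>K\<in>forms (d + e). \<forall>v :: 'k ^ 'n. G v \<noteq> 0 \<longrightarrow> G' v \<noteq> 0 \<longrightarrow> K v / (G v * G' v) = H (F v / G v) (F' v / G' v)"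
  shows "regular_on X U (\<lambda>q. H (f q) (g q))"
  unfolding regular_on_def
proof
  fix p assume p: "p \<in> U"
  obtain V d F G where 1: "open_in X V" "p \<in> V" "V \<subseteq> U" "F \<in> forms d" "G \<in> forms d"
    "\<forall>q\<in>V. \<forall>v\<in>q. G v \<noteq> 0 \<and> f q = F v / G v"
    by (rule regular_onE[OF f p])
  obtain V' e F' G' where 2: "open_in X V'" "p \<in> V'" "V' \<subseteq> U" "F' \<in> forms e" "G' \<in> forms e"
    "\<forall>q\<in>V'. \<forall>v\<in>q. G' v \<noteq> 0 \<and> g q = F' v / G' v"
    by (rule regular_onE[OF g p])
  obtain K where K: "K \<in> forms (d + e)"
    "\<forall>v. G v \<noteq> 0 \<longrightarrow> G' v \<noteq> 0 \<longrightarrow> K v / (G v * G' v) = H (F v / G v) (F' v / G' v)"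
    using H[OF 1(4,5) 2(4,5)] by blast
  have "\<forall>q\<in>V \<inter> V'. \<forall>v\<in>q. (G * G') v \<noteq> 0 \<and> H (f q) (g q) = K v / (G * G') v"
    using 1(6) 2(6) K(2) by auto
  then show "\<exists>V d F G. open_in X V \<and> p \<in> V \<and> V \<subseteq> U \<and> F \<in> forms d \<and> G \<in> forms d \<and>
      (\<forall>q\<in>V. \<forall>v\<in>q. G v \<noteq> 0 \<and> H (f q) (g q) = F v / G v)"
  proof (intro exI conjI)
    show "open_in X (V \<inter> V')" using 1(1) 2(1) by (rule openin_Int)
    show "p \<in> V \<inter> V'" "V \<inter> V' \<subseteq> U" using 1 2 by auto
    show "K \<in> forms (d + e)" "G * G' \<in> forms (d + e)" using K forms_mult[OF 1(5) 2(5)] by auto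
  qed
qed

lemma regular_on_add:
  fixes X :: "('a::field, 'b::finite) ppoint set"
  assumes "regular_on X U f" "regular_on X U g"
  shows "regular_on X U (f + g)"
proof -
  have "regular_on X U (\<lambda>q. f q + g q)"
  proof (rule regular_on_combine[OF assms])
    fix d e and F G F' G' :: "'a ^ 'b \<Rightarrow> 'a" assume a: "F \<in> forms d" "G \<in> forms d" "F' \<in> forms e" "G' \<in> forms e"
    have "F * G' + G * F' \<in> forms (d + e)"
      using a by (intro fs.subspace_add forms_subspace forms_mult)
    thus "\<exists>K\<in>forms (d + e). \<forall>v. G v \<noteq> 0 \<longrightarrow> G' v \<noteq> 0 \<longrightarrow>
        K v / (G v * G' v) = F v / G v + F' v / G' v"
      by (rule bexI[rotated]) (auto simp: field_simps)
  qed
  thus ?thesis by (simp add: plus_fun_def)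
qed

lemma regular_on_mult:
  fixes X :: "('a::field, 'b::finite) ppoint set"
  assumes "regular_on X U f" "regular_on X U g"
  shows "regular_on X U (f * g)"
proof -
  have "regular_on X U (\<lambda>q. f q * g q)"
  proof (rule regular_on_combine[OF assms])
    fix d e and F G F' G' :: "'a ^ 'b \<Rightarrow> 'a" assume a: "F \<in> forms d" "G \<in> forms d" "F' \<in> forms e" "G' \<in> forms e"
    show "\<exists>K\<in>forms (d + e). \<forall>v. G v \<noteq> 0 \<longrightarrow> G' v \<noteq> 0 \<longrightarrow>
        K v / (G v * G' v) = F v / G v * (F' v / G' v)"
      by (rule bexI[OF _ forms_mult[OF a(1,3)]]) auto
  qed
  thus ?thesis by (simp add: times_fun_def)
qed

lemma regular_on_const:
  assumes "open_in X U"
  shows "regular_on X U (\<lambda>_. c)"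
  unfolding regular_on_def
proof
  fix p assume "p \<in> U"
  thus "\<exists>V d F G. open_in X V \<and> p \<in> V \<and> V \<subseteq> U \<and> F \<in> forms d \<and> G \<in> forms d \<and>
      (\<forall>q\<in>V. \<forall>v\<in>q. G v \<noteq> 0 \<and> c = F v / G v)"
    using assms by (intro exI[of _ U] exI[of _ 0] exI[of _ "\<lambda>_. c"] exI[of _ "\<lambda>_. 1"])
      (auto simp: forms_const)
qed

lemma regular_on_fscale:
  assumes "open_in X U" "regular_on X U f"
  shows "regular_on X U (fscale c f)"
  using regular_on_mult[OF regular_on_const[OF assms(1), of c] assms(2)]
  by (simp add: fscale_def times_fun_def)

lemma local_funI: "open_in X U \<Longrightarrow> p \<in> U \<Longrightarrow> regular_on X U f \<Longrightarrow> f \<in> local_fun X p"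
  unfolding local_fun_def by blast

lemma open_in_self: "X \<subseteq> topspace zariski \<Longrightarrow> open_in X X"
  using openin_topspace[of "subtopology zariski X"] by (simp add: Int_absorb1)

lemma local_fun_const: "p \<in> X \<Longrightarrow> X \<subseteq> topspace zariski \<Longrightarrow> (\<lambda>_. c) \<in> local_fun X p"
  by (rule local_funI[of X X]) (auto intro!: regular_on_const open_in_self)

lemma local_fun_add_mult:
  assumes "f \<in> local_fun X p" "g \<in> local_fun X p"
  shows "f + g \<in> local_fun X p" "f * g \<in> local_fun X p"
proof -
  obtain U V where U: "open_in X U" "p \<in> U" "regular_on X U f"
    and V: "open_in X V" "p \<in> V" "regular_on X V g"
    using assms unfolding local_fun_def by blast
  have o: "open_in X (U \<inter> V)" using U V by (auto intro: openin_Int)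
  have r: "regular_on X (U \<inter> V) f" "regular_on X (U \<inter> V) g"
    using regular_on_subset[OF _ o] U V by blast+
  show "f + g \<in> local_fun X p" "f * g \<in> local_fun X p"
    using local_funI[OF o] U V r regular_on_add regular_on_mult by blast+
qed

lemma local_fun_subspace:
  assumes "p \<in> X" "X \<subseteq> topspace zariski"
  shows "fs.subspace (local_fun X p)"
proof -
  have "fscale c f = (\<lambda>_. c) * f" for c and f :: "('a, 'b) ppoint \<Rightarrow> 'a"
    by (auto simp: fscale_def)
  moreover have "0 \<in> local_fun X p"
    using local_fun_const[OF assms, of 0] by (simp add: zero_fun_def)
  ultimately show ?thesis
    unfolding fs.subspace_def using local_fun_add_mult local_fun_const[OF assms] by metis
qed

lemma local_ideal_subspace:
  assumes "p \<in> X" "X \<subseteq> topspace zariski" "local_ideal X p I"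
  shows "fs.subspace I"
proof -
  have "fscale c f = (\<lambda>_. c) * f" for c and f :: "('a, 'b) ppoint \<Rightarrow> 'a"
    by (auto simp: fscale_def)
  thus ?thesis
    using assms local_fun_const[OF assms(1,2)] unfolding fs.subspace_def local_ideal_def by metis
qed

lemma local_ideal_germ: "local_ideal X p I \<Longrightarrow> f \<in> I \<Longrightarrow> germ_eq X p f g \<Longrightarrow> g \<in> I"
  by (auto simp: local_ideal_def)

lemma local_ideal_mult: "local_ideal X p I \<Longrightarrow> f \<in> I \<Longrightarrow> g \<in> local_fun X p \<Longrightarrow> g * f \<in> I"
  by (auto simp: local_ideal_def)

lemma germ_eqI: "open_in X U \<Longrightarrow> p \<in> U \<Longrightarrow> (\<And>q. q \<in> U \<Longrightarrow> f q = g q) \<Longrightarrow> germ_eq X p f g"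
  unfolding germ_eq_def by blast

lemma curry_fun [simp]: "curry (f + g) p = curry f p + curry g p" "curry (f - g) p = curry f p - curry g p"
  "curry (fscale c f) p = fscale c (curry f p)" "curry 0 p = 0"
  by (auto simp: fscale_def)

lemma global_sectionsD:
  assumes "s \<in> global_sections X L"
  shows "i \<in> idx L \<Longrightarrow> regular_on X (patch L i) (curry s i)"
    and "i \<in> idx L \<Longrightarrow> j \<in> idx L \<Longrightarrow> q \<in> patch L i \<Longrightarrow> q \<in> patch L j \<Longrightarrow>
      s (i, q) = trans_fun L i j q * s (j, q)"
    and "i \<notin> idx L \<or> q \<notin> patch L i \<Longrightarrow> s (i, q) = 0"
  using assms unfolding global_sections_def by blast+

lemma global_sectionsI:
  assumes "\<And>i. i \<in> idx L \<Longrightarrow> regular_on X (patch L i) (curry s i)"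
    and "\<And>i j q. i \<in> idx L \<Longrightarrow> j \<in> idx L \<Longrightarrow> q \<in> patch L i \<Longrightarrow> q \<in> patch L j \<Longrightarrow>
      s (i, q) = trans_fun L i j q * s (j, q)"
    and "\<And>i q. i \<notin> idx L \<or> q \<notin> patch L i \<Longrightarrow> s (i, q) = 0"
  shows "s \<in> global_sections X L"
  using assms unfolding global_sections_def by blast

lemma global_sections_subspace:
  assumes "line_bundle X L"
  shows "fs.subspace (global_sections X L)"
proof -
  have o: "open_in X (patch L i)" if "i \<in> idx L" for i
    using assms that by (auto simp: line_bundle_def)
  show ?thesis
  proof (rule fs.subspaceI)
    have "regular_on X (patch L i) 0" if "i \<in> idx L" for i
      using regular_on_const[OF o[OF that], of 0] by (simp add: zero_fun_def)
    thus "0 \<in> global_sections X L" by (simp add: global_sections_def)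
  next
    fix s t assume st: "s \<in> global_sections X L" "t \<in> global_sections X L"
    show "s + t \<in> global_sections X L"
    proof (rule global_sectionsI)
      fix i j q assume ij: "i \<in> idx L" "j \<in> idx L" "q \<in> patch L i" "q \<in> patch L j"
      show "(s + t) (i, q) = trans_fun L i j q * (s + t) (j, q)"
        using global_sectionsD(2)[OF st(1) ij] global_sectionsD(2)[OF st(2) ij]
        by (metis distrib_left plus_fun_apply)
    qed (use global_sectionsD(1,3)[OF st(1)] global_sectionsD(1,3)[OF st(2)] in
        \<open>auto simp: regular_on_add\<close>)
  next
    fix c s assume s: "s \<in> global_sections X L"
    show "fscale c s \<in> global_sections X L"
    proof (rule global_sectionsI)
      fix i j q assume ij: "i \<in> idx L" "j \<in> idx L" "q \<in> patch L i" "q \<in> patch L j"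
      show "fscale c s (i, q) = trans_fun L i j q * fscale c s (j, q)"
        using global_sectionsD(2)[OF s ij] unfolding fscale_def by (metis mult.left_commute)
    next
      fix i q assume "i \<notin> idx L \<or> q \<notin> patch L i"
      thus "fscale c s (i, q) = 0" using global_sectionsD(3)[OF s] by (simp add: fscale_def)
    qed (use global_sectionsD(1)[OF s] in \<open>simp add: regular_on_fscale[OF o]\<close>)
  qed
qed

subsection \<open>Quotients of finite products\<close>

definition fprod :: "'p set \<Rightarrow> ('p \<Rightarrow> ('q \<Rightarrow> 'k::field) set) \<Rightarrow> ('p \<times> 'q \<Rightarrow> 'k) set" where
  "fprod P R = {t. (\<forall>p\<in>P. curry t p \<in> R p) \<and> (\<forall>p q. p \<notin> P \<longrightarrow> t (p, q) = 0)}"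

lemma fprod_subspace:
  assumes "\<And>p. p \<in> P \<Longrightarrow> fs.subspace (R p)"
  shows "fs.subspace (fprod P R)"
proof (rule fs.subspaceI)
  show "0 \<in> fprod P R" using fs.subspace_0[OF assms] by (simp add: fprod_def)
next
  fix s t assume "s \<in> fprod P R" "t \<in> fprod P R"
  thus "s + t \<in> fprod P R" using fs.subspace_add[OF assms] by (simp add: fprod_def)
next
  fix c s assume "s \<in> fprod P R"
  thus "fscale c s \<in> fprod P R"
    using fs.subspace_scale[OF assms] by (simp add: fprod_def) (simp add: fscale_def)
qed

lemma quot_dim_fprod:
  fixes R Z :: "'a \<Rightarrow> ('b \<Rightarrow> 'c::field) set"
  assumes "finite P"
    and "\<And>p. p \<in> P \<Longrightarrow> fs.subspace (R p)" "\<And>p. p \<in> P \<Longrightarrow> fs.subspace (Z p)"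
    and "\<And>p. p \<in> P \<Longrightarrow> Z p \<subseteq> R p"
  shows "quot_dim (fprod P R) (fprod P Z) = (\<Sum>p\<in>P. quot_dim (R p) (Z p))"
  using assms
proof (induction P rule: finite_induct)
  case empty
  have "fprod {} R = fprod {} Z" by (auto simp: fprod_def)
  thus ?case using quot_dim_eq_0[OF fprod_subspace[of "{}" Z] order.refl] by simp
next
  case (insert a P)
  let ?T = "fprod (insert a P) R" and ?TZ = "fprod (insert a P) Z"
  let ?\<phi> = "\<lambda>t::'a \<times> 'b \<Rightarrow> 'c. curry t a" and ?\<psi> = "\<lambda>(t::'a \<times> 'b \<Rightarrow> 'c) (p, q). if p \<in> P then t (p, q) else 0"
  let ?M = "{t \<in> ?T. ?\<phi> t \<in> Z a}"
  have sT: "fs.subspace ?T" "fs.subspace ?TZ" "fs.subspace (fprod P R)" "fs.subspace (fprod P Z)"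
    using insert.prems by (auto intro!: fprod_subspace)
  have s0: "0 \<in> R p" "0 \<in> Z p" if "p \<in> insert a P" for p
    using insert.prems(1,2)[OF that] fs.subspace_0 by auto
  have sM: "fs.subspace ?M"
    using sT insert.prems(2)[of a] unfolding fs.subspace_def by auto
  have 1: "quot_dim ?T ?M = quot_dim (R a) (Z a)"
  proof (rule quot_dim_image)
    fix x assume x: "x \<in> R a"
    define t where "t = (\<lambda>(p, q). if p = a then x q else 0)"
    have "curry t a = x" and "\<And>p. p \<noteq> a \<Longrightarrow> curry t p = 0" by (auto simp: t_def fun_eq_iff)
    have "curry t p \<in> R p" if "p \<in> insert a P" for p
      using that \<open>curry t a = x\<close> \<open>\<And>p. p \<noteq> a \<Longrightarrow> curry t p = 0\<close> x s0(1) by (cases "p = a") auto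
    moreover have "t (p, q) = 0" if "p \<notin> insert a P" for p q using that by (simp add: t_def)
    ultimately have "t \<in> ?T" unfolding fprod_def by blast
    thus "\<exists>v\<in>?T. \<exists>t\<in>Z a. x = ?\<phi> v + t"
      using \<open>curry t a = x\<close> s0 by (intro bexI[of _ t] bexI[of _ 0]) auto
  qed (use sT insert.prems in \<open>auto simp: fprod_def\<close>)
  have \<psi>: "curry (?\<psi> t) p = (if p \<in> P then curry t p else 0)" for t p by (auto simp: fun_eq_iff)
  have M0: "?TZ = {t \<in> ?M. ?\<psi> t \<in> fprod P Z}"
    using insert.prems(3) unfolding fprod_def mem_Collect_eq \<psi> by (auto simp: subset_iff)
  have 2: "quot_dim ?M {t \<in> ?M. ?\<psi> t \<in> fprod P Z} = quot_dim (fprod P R) (fprod P Z)"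
  proof (rule quot_dim_image)
    fix x assume x: "x \<in> fprod P R"
    have "curry x a = 0" "?\<psi> x = x" using x insert.hyps by (auto simp: fprod_def fun_eq_iff)
    moreover have "x \<in> ?M" using x s0 \<open>curry x a = 0\<close> by (auto simp: fprod_def)
    moreover have "0 \<in> fprod P Z" using sT fs.subspace_0 by blast
    ultimately show "\<exists>v\<in>?M. \<exists>t\<in>fprod P Z. x = ?\<psi> v + t"
      by (intro bexI[of _ x] bexI[of _ 0]) auto
  next
    show "?\<psi> ` ?M \<subseteq> fprod P R" by (auto simp: fprod_def curry_def)
    show "fprod P Z \<subseteq> fprod P R" using insert.prems(3) unfolding fprod_def by blast
  qed (use sT sM in \<open>auto simp: fscale_def fun_eq_iff\<close>)
  have "quot_dim ?T ?TZ = quot_dim ?M ?TZ + quot_dim ?T ?M"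
    by (rule quot_dim_add) (use sT sM M0 in auto)
  thus ?case using 1 2 M0 insert by (simp add: add.commute)
qed

subsection \<open>The criterion\<close>

lemma independent_conditions_iff_h0:
  fixes X :: "('k::field, 'n::finite) ppoint set" and L :: "('k, 'n, 'i) lbundle"
  assumes L: "line_bundle X L" and Z: "zero_dim_subscheme X Z" and fin: "h0 X L \<noteq> \<infinity>"
  shows "independent_conditions X Z L \<longleftrightarrow> h0_ideal X Z L + scheme_length X Z = h0 X L"
proof -
  define P where "P = scheme_support X Z"
  have finP: "finite P" and PX: "P \<subseteq> X" and ZI: "\<And>p. p \<in> X \<Longrightarrow> local_ideal X p (Z p)"
    and lenfin: "\<And>p. p \<in> X \<Longrightarrow> quot_dim (local_fun X p) (Z p) \<noteq> \<infinity>"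
    using Z by (auto simp: zero_dim_subscheme_def P_def scheme_support_def)
  have o: "open_in X (patch L j)" if "j \<in> idx L" for j
    using L that by (simp add: line_bundle_def)
  have cover: "(\<Union>j\<in>idx L. patch L j) = X"
    and greg: "\<And>j k. j \<in> idx L \<Longrightarrow> k \<in> idx L \<Longrightarrow>
      regular_on X (patch L j \<inter> patch L k) (trans_fun L j k)"
    and gid: "\<And>j q. j \<in> idx L \<Longrightarrow> q \<in> patch L j \<Longrightarrow> trans_fun L j j q = 1"
    and gcoc: "\<And>j k l q. j \<in> idx L \<Longrightarrow> k \<in> idx L \<Longrightarrow> l \<in> idx L \<Longrightarrow>
      q \<in> patch L j \<Longrightarrow> q \<in> patch L k \<Longrightarrow> q \<in> patch L l \<Longrightarrow>
      trans_fun L j k q * trans_fun L k l q = trans_fun L j l q"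
    using L by (auto simp: line_bundle_def)
  have XT: "X \<subseteq> topspace zariski"
    using cover openin_subset[OF o] by fastforce
  have o2: "open_in X (patch L j \<inter> patch L k)" if "j \<in> idx L" "k \<in> idx L" for j k
    using o that by (intro openin_Int)
  have "\<forall>p\<in>P. \<exists>j\<in>idx L. p \<in> patch L j" using PX cover by blast
  then obtain i where i: "\<And>p. p \<in> P \<Longrightarrow> i p \<in> idx L" "\<And>p. p \<in> P \<Longrightarrow> p \<in> patch L (i p)" by metis
  have gloc: "trans_fun L j k \<in> local_fun X p"
    if "j \<in> idx L" "k \<in> idx L" "p \<in> patch L j" "p \<in> patch L k" for j k p
    using local_funI[OF o2[OF that(1,2)] _ greg[OF that(1,2)]] that by simp
  have sR: "fs.subspace (local_fun X p)" "fs.subspace (Z p)" "Z p \<subseteq> local_fun X p" if "p \<in> P" for p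
  proof -
    have p: "p \<in> X" using that PX by blast
    show "fs.subspace (local_fun X p)" "fs.subspace (Z p)" "Z p \<subseteq> local_fun X p"
      using local_fun_subspace[OF p XT] local_ideal_subspace[OF p XT ZI[OF p]] ZI[OF p]
      unfolding local_ideal_def by blast+
  qed

  define V where "V = global_sections X L"
  define T where "T = fprod P (local_fun X)"
  define TZ where "TZ = fprod P Z"
  define \<phi> where "\<phi> s = (\<lambda>(p, q). if p \<in> P then s (i p, q) else 0)"
    for s :: "'i \<times> ('k, 'n) ppoint \<Rightarrow> 'k"
  have curry_\<phi>: "curry (\<phi> s) p = curry s (i p)" if "p \<in> P" for s p
    using that by (simp add: \<phi>_def curry_def)
  have \<phi>0: "\<phi> s (p, q) = 0" if "p \<notin> P" for s p q using that by (simp add: \<phi>_def)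
  have \<phi>_add: "\<phi> (s + t) = \<phi> s + \<phi> t" for s t by (auto simp: \<phi>_def fun_eq_iff)
  have \<phi>_scale: "\<phi> (fscale c s) = fscale c (\<phi> s)" for s c
    by (auto simp: \<phi>_def fun_eq_iff fscale_def)
  interpret \<phi>: Vector_Spaces.linear fscale fscale \<phi>
    by unfold_locales (use \<phi>_add \<phi>_scale in auto)
  have sV: "fs.subspace V" unfolding V_def by (rule global_sections_subspace[OF L])
  have sT: "fs.subspace T" "fs.subspace TZ"
    unfolding T_def TZ_def by (rule fprod_subspace, erule sR)+
  have TZT: "TZ \<subseteq> T" unfolding T_def TZ_def fprod_def using sR(3) by blast

  have W: "ideal_sections X Z L = {s \<in> V. \<phi> s \<in> TZ}"
  proof (intro equalityI subsetI)
    fix s assume s: "s \<in> ideal_sections X Z L"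
    have "curry (\<phi> s) p \<in> Z p" if "p \<in> P" for p
      using s i[OF that] PX that unfolding ideal_sections_def curry_\<phi>[OF that] by blast
    thus "s \<in> {s \<in> V. \<phi> s \<in> TZ}"
      using s \<phi>0 unfolding ideal_sections_def V_def TZ_def fprod_def by blast
  next
    fix s assume "s \<in> {s \<in> V. \<phi> s \<in> TZ}"
    hence s: "s \<in> global_sections X L" and "\<phi> s \<in> TZ" by (auto simp: V_def)
    hence sZ: "curry s (i p) \<in> Z p" if "p \<in> P" for p
      using curry_\<phi>[OF that, of s] that unfolding TZ_def fprod_def by auto
    have "curry s j \<in> Z p" if j: "p \<in> X" "j \<in> idx L" "p \<in> patch L j" for p j
    proof (cases "p \<in> P")
      case False
      hence "Z p = local_fun X p" using j(1) by (auto simp: P_def scheme_support_def)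
      thus ?thesis using local_funI[OF o[OF j(2)] j(3) global_sectionsD(1)[OF s j(2)]] by simp
    next
      case True
      have "trans_fun L j (i p) * curry s (i p) \<in> Z p"
        by (rule local_ideal_mult[OF ZI[OF j(1)] sZ[OF True] gloc[OF j(2) i(1)[OF True] j(3) i(2)[OF True]]])
      moreover have "germ_eq X p (trans_fun L j (i p) * curry s (i p)) (curry s j)"
      proof (rule germ_eqI[OF o2[OF j(2) i(1)[OF True]]])
        fix q assume "q \<in> patch L j \<inter> patch L (i p)"
        thus "(trans_fun L j (i p) * curry s (i p)) q = curry s j q"
          using global_sectionsD(2)[OF s j(2) i(1)[OF True], of q] by simp
      qed (use j i(2)[OF True] in simp)
      ultimately show ?thesis by (rule local_ideal_germ[OF ZI[OF j(1)]])
    qed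
    thus "s \<in> ideal_sections X Z L" using s unfolding ideal_sections_def by blast
  qed
  have sW: "fs.subspace (ideal_sections X Z L)"
    unfolding W using sV sT(2) \<phi>.zero \<phi>_add \<phi>_scale unfolding fs.subspace_def by auto

  define U where "U = {x + t | x t. x \<in> \<phi> ` V \<and> t \<in> TZ}"
  have sU: "fs.subspace U"
    unfolding U_def by (intro fs.subspace_sums \<phi>.subspace_image sV sT)
  have \<phi>V: "\<phi> s \<in> T" if "s \<in> V" for s
  proof -
    have "curry (\<phi> s) p \<in> local_fun X p" if p: "p \<in> P" for p
      unfolding curry_\<phi>[OF p]
      by (rule local_funI[OF o[OF i(1)] i(2) global_sectionsD(1)[OF _ i(1)]])
         (use p \<open>s \<in> V\<close> in \<open>auto simp: V_def\<close>)
    thus ?thesis unfolding T_def fprod_def using \<phi>0 by blast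
  qed
  have UT: "U \<subseteq> T" unfolding U_def using \<phi>V sT fs.subspace_add[OF sT(1)] TZT by blast
  have TU: "TZ \<subseteq> U"
  proof
    fix t assume "t \<in> TZ"
    moreover have "0 \<in> \<phi> ` V" using fs.subspace_0[OF \<phi>.subspace_image[OF sV]] .
    ultimately have "0 + t \<in> U" unfolding U_def by blast
    thus "t \<in> U" by simp
  qed
  have \<phi>U: "\<phi> ` V \<subseteq> U"
  proof
    fix x assume "x \<in> \<phi> ` V"
    moreover have "0 \<in> TZ" by (rule fs.subspace_0[OF sT(2)])
    ultimately have "x + 0 \<in> U" unfolding U_def by blast
    thus "x \<in> U" by simp
  qed
  have d1: "quot_dim V (ideal_sections X Z L) = quot_dim U TZ"
    unfolding W
    by (rule quot_dim_image[OF \<phi>_add \<phi>_scale sV sT(2) sU \<phi>U TU]) (auto simp: U_def)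
  have d2: "h0 X L = h0_ideal X Z L + quot_dim V (ideal_sections X Z L)"
    unfolding h0_def h0_ideal_def V_def[symmetric]
  proof (rule quot_dim_add[OF _ sW _ _ sV])
    show "fs.subspace {0 :: 'i \<times> ('k, 'n) ppoint \<Rightarrow> 'k}" by (rule fs.subspace_single_0)
    show "{0} \<subseteq> ideal_sections X Z L" using fs.subspace_0[OF sW] by simp
    show "ideal_sections X Z L \<subseteq> V" unfolding W by blast
  qed
  have len: "scheme_length X Z = quot_dim T TZ"
    unfolding scheme_length_def T_def TZ_def P_def[symmetric]
    by (rule quot_dim_fprod[symmetric]) (use finP sR in auto)
  have d3: "quot_dim T TZ = quot_dim U TZ + quot_dim T U"
    by (rule quot_dim_add[OF sT(2) sU TU UT sT(1)])
  have "scheme_length X Z \<noteq> \<infinity>"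
    unfolding scheme_length_def P_def[symmetric] using finP PX
  proof (induction P rule: finite_induct)
    case (insert x F)
    thus ?case using lenfin[of x] by (simp add: plus_eq_infty_iff_enat)
  qed simp
  then obtain a b where ab: "quot_dim U TZ = enat a" "quot_dim T U = enat b"
    using d3 len by (cases "quot_dim U TZ"; cases "quot_dim T U") auto
  obtain c where c: "h0_ideal X Z L = enat c"
    using d2 fin by (cases "h0_ideal X Z L") auto
  have eq: "h0_ideal X Z L + scheme_length X Z = h0 X L \<longleftrightarrow> T = U"
    using quot_dim_eq_0[OF sU UT] ab by (simp add: d1 d2 len d3 c zero_enat_def)

  have "independent_conditions X Z L \<longleftrightarrow> T \<subseteq> U"
  proof
    assume ind: "independent_conditions X Z L"
    show "T \<subseteq> U"
    proof
      fix t assume t: "t \<in> T"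
      have tp: "curry t p \<in> local_fun X p" if "p \<in> P" for p
        using t that unfolding T_def fprod_def by blast
      have t0: "t (p, q) = 0" if "p \<notin> P" for p q
        using t that unfolding T_def fprod_def by blast
      define \<tau> where "\<tau> p = (\<lambda>(j, q). trans_fun L j (i p) q * t (p, q))" for p
      have \<tau>: "curry (\<tau> p) j = trans_fun L j (i p) * curry t p" for p j
        by (auto simp: \<tau>_def)
      have "\<tau> p \<in> bundle_stalk X L p" if p: "p \<in> P" for p
        unfolding bundle_stalk_def mem_Collect_eq
      proof (intro conjI ballI impI)
        fix j assume j: "j \<in> idx L" "p \<in> patch L j"
        show "curry (\<tau> p) j \<in> local_fun X p"
          unfolding \<tau> using local_fun_add_mult(2)[OF gloc[OF j(1) i(1) j(2) i(2)] tp] p by blast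
      next
        fix j k assume jk: "j \<in> idx L" "k \<in> idx L" "p \<in> patch L j \<inter> patch L k"
        show "germ_eq X p (curry (\<tau> p) j) (trans_fun L j k * curry (\<tau> p) k)"
        proof (rule germ_eqI)
          show "open_in X (patch L j \<inter> patch L k \<inter> patch L (i p))"
            using o2[OF jk(1,2)] o[OF i(1)[OF p]] by (rule openin_Int)
          show "p \<in> patch L j \<inter> patch L k \<inter> patch L (i p)" using jk i(2)[OF p] by blast
          fix q assume "q \<in> patch L j \<inter> patch L k \<inter> patch L (i p)"
          hence "trans_fun L j k q * trans_fun L k (i p) q = trans_fun L j (i p) q"
            using gcoc[OF jk(1,2) i(1)[OF p]] by blast
          thus "curry (\<tau> p) j q = (trans_fun L j k * curry (\<tau> p) k) q"
            by (simp add: \<tau>_def mult.assoc[symmetric])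
        qed
      qed
      hence "\<forall>p\<in>P. \<tau> p \<in> bundle_stalk X L p" by blast
      with ind have "\<exists>s\<in>V. \<forall>p\<in>P. \<forall>j\<in>idx L. p \<in> patch L j \<longrightarrow>
          curry s j - curry (\<tau> p) j \<in> Z p"
        unfolding independent_conditions_def P_def[symmetric] V_def[symmetric]
        by (elim allE[of _ \<tau>] impE)
      then obtain s where s: "s \<in> V" and
        sZ: "\<And>p j. p \<in> P \<Longrightarrow> j \<in> idx L \<Longrightarrow> p \<in> patch L j \<Longrightarrow> curry s j - curry (\<tau> p) j \<in> Z p"
        by blast
      have "curry (t - \<phi> s) p \<in> Z p" if p: "p \<in> P" for p
      proof -
        have "germ_eq X p (curry s (i p) - curry (\<tau> p) (i p)) (curry s (i p) - curry t p)"
          by (rule germ_eqI[OF o[OF i(1)[OF p]] i(2)[OF p]])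
             (simp add: \<tau>_def gid[OF i(1)[OF p]])
        with sZ[OF p i(1)[OF p] i(2)[OF p]] have "curry s (i p) - curry t p \<in> Z p"
          using local_ideal_germ[OF ZI] PX p by blast
        hence "- (curry s (i p) - curry t p) \<in> Z p"
          by (rule fs.subspace_neg[OF sR(2)[OF p]])
        thus ?thesis by (simp add: curry_\<phi>[OF p])
      qed
      hence "t - \<phi> s \<in> TZ" unfolding TZ_def fprod_def using t0 \<phi>0 by simp
      hence "\<phi> s + (t - \<phi> s) \<in> U" unfolding U_def using s by blast
      thus "t \<in> U" by simp
    qed
  next
    assume sub: "T \<subseteq> U"
    show "independent_conditions X Z L"
      unfolding independent_conditions_def P_def[symmetric] V_def[symmetric]
    proof (intro allI impI)
      fix \<tau> assume \<tau>: "\<forall>p\<in>P. \<tau> p \<in> bundle_stalk X L p"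
      have \<tau>D: "\<And>p j. p \<in> P \<Longrightarrow> j \<in> idx L \<Longrightarrow> p \<in> patch L j \<Longrightarrow> curry (\<tau> p) j \<in> local_fun X p"
        "\<And>p j k. p \<in> P \<Longrightarrow> j \<in> idx L \<Longrightarrow> k \<in> idx L \<Longrightarrow> p \<in> patch L j \<Longrightarrow> p \<in> patch L k \<Longrightarrow>
          germ_eq X p (curry (\<tau> p) j) (trans_fun L j k * curry (\<tau> p) k)"
        using \<tau> unfolding bundle_stalk_def by blast+
      define t where "t = (\<lambda>(p, q). if p \<in> P then \<tau> p (i p, q) else 0)"
      have tc: "curry t p = curry (\<tau> p) (i p)" if "p \<in> P" for p
        using that by (simp add: t_def curry_def)
      have "t (p, q) = 0" if "p \<notin> P" for p q using that by (simp add: t_def)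
      moreover have "curry t p \<in> local_fun X p" if "p \<in> P" for p
        unfolding tc[OF that] using \<tau>D(1)[OF that i(1)[OF that] i(2)[OF that]] .
      ultimately have "t \<in> T" unfolding T_def fprod_def by blast
      hence "t \<in> U" using sub by blast
      then obtain s z where sz: "s \<in> V" "z \<in> TZ" "t = \<phi> s + z" unfolding U_def by blast
      have main: "curry s (i p) - curry (\<tau> p) (i p) \<in> Z p" if p: "p \<in> P" for p
      proof -
        have "curry z p \<in> Z p" using sz(2) p unfolding TZ_def fprod_def by blast
        hence "- curry z p \<in> Z p" by (rule fs.subspace_neg[OF sR(2)[OF p]])
        moreover have "curry t p = curry s (i p) + curry z p" using sz(3) curry_\<phi>[OF p] by simp
        ultimately show ?thesis using tc[OF p] by simp
      qed
      have "curry s j - curry (\<tau> p) j \<in> Z p" if p: "p \<in> P" and j: "j \<in> idx L" "p \<in> patch L j" for p j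
      proof -
        note ip = i(1)[OF p] i(2)[OF p]
        obtain N where N: "open_in X N" "p \<in> N"
          "\<forall>q\<in>N. curry (\<tau> p) j q = (trans_fun L j (i p) * curry (\<tau> p) (i p)) q"
          using \<tau>D(2)[OF p j(1) ip(1) j(2) ip(2)] unfolding germ_eq_def by blast
        have "trans_fun L j (i p) * (curry s (i p) - curry (\<tau> p) (i p)) \<in> Z p"
          by (rule local_ideal_mult[OF ZI main[OF p] gloc[OF j(1) ip(1) j(2) ip(2)]]) (use p PX in blast)
        moreover have "germ_eq X p (trans_fun L j (i p) * (curry s (i p) - curry (\<tau> p) (i p)))
            (curry s j - curry (\<tau> p) j)"
        proof (rule germ_eqI)
          show "open_in X (N \<inter> (patch L j \<inter> patch L (i p)))"
            using N(1) o2[OF j(1) ip(1)] by (rule openin_Int)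
          show "p \<in> N \<inter> (patch L j \<inter> patch L (i p))" using N j ip by blast
          fix q assume q: "q \<in> N \<inter> (patch L j \<inter> patch L (i p))"
          have "s (j, q) = trans_fun L j (i p) q * s (i p, q)"
            using global_sectionsD(2)[of s X L j "i p" q] sz(1) j ip q unfolding V_def by blast
          moreover have "\<tau> p (j, q) = trans_fun L j (i p) q * \<tau> p (i p, q)" using N(3) q by simp
          ultimately show "(trans_fun L j (i p) * (curry s (i p) - curry (\<tau> p) (i p))) q =
              (curry s j - curry (\<tau> p) j) q" by (simp add: right_diff_distrib)
        qed
        ultimately show ?thesis using local_ideal_germ[OF ZI] p PX by blast
      qed
      thus "\<exists>s\<in>V. \<forall>p\<in>P. \<forall>j\<in>idx L. p \<in> patch L j \<longrightarrow> curry s j - curry (\<tau> p) j \<in> Z p"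
        using sz(1) by blast
    qed
  qed
  thus ?thesis using eq UT by blast
qed

end

theory Submission
  imports Defs
begin

text \<open>
  Fix \<open>p \<in> S\<close>. Condition \<open>\<dagger>\<close> gives sections \<open>s\<^sub>1\<close> of \<open>L\<^sub>1\<close> that vanish on \<open>S - {p}\<close> and have a
  prescribed expansion modulo \<open>\<mm>\<^sub>p\<^sup>2\<close> at \<open>p\<close>; the hypothesis on \<open>L\<^sub>2\<close> gives a section \<open>s\<^sub>2\<close> that vanishes
  on \<open>S - {p}\<close> and takes the value \<open>1\<close> at \<open>p\<close>. At every other point of \<open>S\<close> both factors vanish, so
  \<open>s\<^sub>1 \<otimes> s\<^sub>2\<close> vanishes to order two there. At \<open>p\<close> the factor \<open>s\<^sub>2\<close> is a unit, so \<open>s\<^sub>1 \<otimes> s\<^sub>2\<close> still has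
  an arbitrary expansion modulo \<open>\<mm>\<^sub>p\<^sup>2\<close>. Sums of such products over \<open>p \<in> S\<close> realise every element of
  \<open>H\<^sup>0((L\<^sub>1 \<otimes> L\<^sub>2)|\<^bsub>2S\<^esub>)\<close> (\<open>independent_conditions_tensor\<close>).

  For the dimensions, surjectivity of the restriction identifies \<open>H\<^sup>0(L) / H\<^sup>0(I\<^sub>Z \<otimes> L)\<close> with the
  functions on \<open>Z\<close> (\<open>independent_conditions_h0\<close>), and a double point at a smooth point has length
  \<open>n + 1\<close>, from \<open>dim(O\<^sub>p / \<mm>\<^sub>p) = 1\<close> and \<open>dim(\<mm>\<^sub>p / \<mm>\<^sub>p\<^sup>2) = n\<close>. With the equality of dimensions, the
  strict inequality that defines the Terracini locus fails, also when \<open>h\<^sup>0\<close> takes the value \<open>\<infinity>\<close>.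

  Both parts rest on \<open>independent_conditions_charts\<close>, which replaces the stalks of a line bundle by
  germs of functions in one fixed trivialisation at each point.
\<close>

section \<open>Germs and the square of the maximal ideal\<close>

lemma germ_eq_combine:
  assumes "germ_eq X p f f'" "germ_eq X p g g'"
  shows "germ_eq X p (\<lambda>q. H (f q) (g q)) (\<lambda>q. H (f' q) (g' q))"
proof -
  obtain U V where "open_in X U" "p \<in> U" "\<forall>q\<in>U. f q = f' q"
    and "open_in X V" "p \<in> V" "\<forall>q\<in>V. g q = g' q"
    using assms unfolding germ_eq_def by blast
  thus ?thesis by (intro germ_eqI[of X "U \<inter> V"]) (auto intro: openin_Int)
qed

lemma germ_eq_add: "germ_eq X p f f' \<Longrightarrow> germ_eq X p g g' \<Longrightarrow> germ_eq X p (f + g) (f' + g')"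
  using germ_eq_combine[of X p f f' g g' "(+)"] by (simp add: plus_fun_def)

lemma germ_eq_diff: "germ_eq X p f f' \<Longrightarrow> germ_eq X p g g' \<Longrightarrow> germ_eq X p (f - g) (f' - g')"
  using germ_eq_combine[of X p f f' g g' "(-)"] by (simp add: fun_diff_def)

lemma germ_eq_mult: "germ_eq X p f f' \<Longrightarrow> germ_eq X p g g' \<Longrightarrow> germ_eq X p (f * g) (f' * g')"
  using germ_eq_combine[of X p f f' g g' "(*)"] by (simp add: times_fun_def)

lemma germ_eq_sym: "germ_eq X p f g \<Longrightarrow> germ_eq X p g f"
  unfolding germ_eq_def by metis

lemma germ_eq_trans:
  assumes "germ_eq X p f g" "germ_eq X p g h"
  shows "germ_eq X p f h"
proof -
  obtain U V where "open_in X U" "p \<in> U" "\<forall>q\<in>U. f q = g q"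
    and "open_in X V" "p \<in> V" "\<forall>q\<in>V. g q = h q"
    using assms unfolding germ_eq_def by blast
  thus ?thesis by (intro germ_eqI[of X "U \<inter> V"]) (auto intro: openin_Int)
qed

lemma germ_eq_refl:
  assumes "p \<in> X" "X \<subseteq> topspace zariski"
  shows "germ_eq X p f f"
  using germ_eqI[OF open_in_self[OF assms(2)] assms(1)] by blast

lemma germ_eq_at: "germ_eq X p f g \<Longrightarrow> f p = g p"
  unfolding germ_eq_def by blast

lemma regular_on_cong:
  assumes "regular_on X U f" "\<And>q. q \<in> U \<Longrightarrow> f q = g q"
  shows "regular_on X U g"
  unfolding regular_on_def
proof
  fix p assume p: "p \<in> U"
  obtain V d F G where V: "open_in X V" "p \<in> V" "V \<subseteq> U" "F \<in> forms d" "G \<in> forms d"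
    "\<forall>q\<in>V. \<forall>v\<in>q. G v \<noteq> 0 \<and> f q = F v / G v"
    by (rule regular_onE[OF assms(1) p])
  have "\<forall>q\<in>V. \<forall>v\<in>q. G v \<noteq> 0 \<and> g q = F v / G v"
  proof
    fix q assume "q \<in> V"
    thus "\<forall>v\<in>q. G v \<noteq> 0 \<and> g q = F v / G v" using V(6) assms(2)[of q] V(3) by fastforce
  qed
  with V(1-5) show "\<exists>V d F G. open_in X V \<and> p \<in> V \<and> V \<subseteq> U \<and> F \<in> forms d \<and> G \<in> forms d \<and>
      (\<forall>q\<in>V. \<forall>v\<in>q. G v \<noteq> 0 \<and> g q = F v / G v)"
    by (intro exI conjI)
qed

lemma local_fun_germ:
  assumes "f \<in> local_fun X p" "germ_eq X p f g"
  shows "g \<in> local_fun X p"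
proof -
  obtain U where U: "open_in X U" "p \<in> U" "regular_on X U f"
    using assms(1) unfolding local_fun_def by blast
  obtain V where V: "open_in X V" "p \<in> V" "\<forall>q\<in>V. f q = g q"
    using assms(2) unfolding germ_eq_def by blast
  have o: "open_in X (U \<inter> V)" using U(1) V(1) by (rule openin_Int)
  have "regular_on X (U \<inter> V) f" by (rule regular_on_subset[OF U(3) o]) simp
  hence "regular_on X (U \<inter> V) g" by (rule regular_on_cong) (simp add: V(3))
  from local_funI[OF o _ this] show ?thesis using U(2) V(2) by blast
qed

lemma local_ideal_local_fun:
  assumes "p \<in> X" "X \<subseteq> topspace zariski"
  shows "local_ideal X p (local_fun X p)"
  unfolding local_ideal_def
proof (intro conjI ballI allI impI)
  show "0 \<in> local_fun X p" by (rule fs.subspace_0[OF local_fun_subspace[OF assms]])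
qed (simp_all add: local_fun_add_mult local_fun_germ[of _ X p])

lemma local_ideal_max_ideal:
  assumes "p \<in> X" "X \<subseteq> topspace zariski"
  shows "local_ideal X p (max_ideal X p)"
  unfolding local_ideal_def
proof (intro conjI ballI allI impI)
  show "0 \<in> max_ideal X p"
    using fs.subspace_0[OF local_fun_subspace[OF assms]] by (simp add: max_ideal_def)
next
  fix f g assume "f \<in> max_ideal X p" "germ_eq X p f g"
  thus "g \<in> max_ideal X p"
    using local_fun_germ[of f X p g] germ_eq_at[of X p f g] by (simp add: max_ideal_def)
qed (auto simp: max_ideal_def local_fun_add_mult)

lemma sum_fun_apply: "(\<Sum>j\<in>A. F j) x = (\<Sum>j\<in>A. F j x)"
  by (induction A rule: infinite_finite_induct) auto

lemma sum_lessThan_add: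
  fixes F :: "nat \<Rightarrow> 'a::comm_monoid_add"
  shows "(\<Sum>j<m + n. F j) = (\<Sum>j<m. F j) + (\<Sum>j<n. F (m + j))"
  by (induction n) (auto simp: add.assoc)

lemma max_ideal_square_subset: "max_ideal_square X p \<subseteq> max_ideal X p"
proof
  fix f assume f: "f \<in> max_ideal_square X p"
  then obtain m :: nat and g h where
    gh: "\<forall>j<m. g j \<in> max_ideal X p \<and> h j \<in> max_ideal X p" "germ_eq X p f (\<Sum>j<m. g j * h j)"
    unfolding max_ideal_square_def by blast
  have "f p = (\<Sum>j<m. g j * h j) p" by (rule germ_eq_at[OF gh(2)])
  also have "\<dots> = 0" unfolding sum_fun_apply using gh(1) by (auto simp: max_ideal_def)
  finally show "f \<in> max_ideal X p" using f by (simp add: max_ideal_def max_ideal_square_def)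
qed

lemma local_ideal_max_ideal_square:
  assumes "p \<in> X" "X \<subseteq> topspace zariski"
  shows "local_ideal X p (max_ideal_square X p)"
  unfolding local_ideal_def
proof (intro conjI ballI allI impI)
  show "max_ideal_square X p \<subseteq> local_fun X p" by (auto simp: max_ideal_square_def)
  show "0 \<in> max_ideal_square X p"
    using fs.subspace_0[OF local_fun_subspace[OF assms]] germ_eq_refl[OF assms]
    by (auto simp: max_ideal_square_def intro!: exI[of _ "0::nat"])
next
  fix f f' assume f: "f \<in> max_ideal_square X p" and f': "f' \<in> max_ideal_square X p"
  obtain m :: nat and g h where
    gh: "\<forall>j<m. g j \<in> max_ideal X p \<and> h j \<in> max_ideal X p" "germ_eq X p f (\<Sum>j<m. g j * h j)"
    using f unfolding max_ideal_square_def by blast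
  obtain m' :: nat and g' h' where
    gh': "\<forall>j<m'. g' j \<in> max_ideal X p \<and> h' j \<in> max_ideal X p"
      "germ_eq X p f' (\<Sum>j<m'. g' j * h' j)"
    using f' unfolding max_ideal_square_def by blast
  define G where "G j = (if j < m then g j else g' (j - m))" for j
  define H where "H j = (if j < m then h j else h' (j - m))" for j
  have "(\<Sum>j<m + m'. G j * H j) = (\<Sum>j<m. g j * h j) + (\<Sum>j<m'. g' j * h' j)"
    unfolding sum_lessThan_add by (simp add: G_def H_def)
  hence "germ_eq X p (f + f') (\<Sum>j<m + m'. G j * H j)"
    using germ_eq_add[OF gh(2) gh'(2)] by simp
  moreover have "\<forall>j<m + m'. G j \<in> max_ideal X p \<and> H j \<in> max_ideal X p"
    using gh(1) gh'(1) by (auto simp: G_def H_def)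
  moreover have "f + f' \<in> local_fun X p"
    using f f' local_fun_add_mult(1) by (auto simp: max_ideal_square_def)
  ultimately show "f + f' \<in> max_ideal_square X p" unfolding max_ideal_square_def by blast
next
  fix f r assume f: "f \<in> max_ideal_square X p" and r: "r \<in> local_fun X p"
  obtain m :: nat and g h where
    gh: "\<forall>j<m. g j \<in> max_ideal X p \<and> h j \<in> max_ideal X p" "germ_eq X p f (\<Sum>j<m. g j * h j)"
    using f unfolding max_ideal_square_def by blast
  have "germ_eq X p (r * f) (r * (\<Sum>j<m. g j * h j))"
    by (rule germ_eq_mult[OF germ_eq_refl[OF assms] gh(2)])
  hence "germ_eq X p (r * f) (\<Sum>j<m. (r * g j) * h j)"
    by (simp add: sum_distrib_left mult.assoc)
  moreover have "\<forall>j<m. r * g j \<in> max_ideal X p \<and> h j \<in> max_ideal X p"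
    using gh(1) local_ideal_mult[OF local_ideal_max_ideal[OF assms] _ r] by blast
  moreover have "r * f \<in> local_fun X p"
    using f r local_fun_add_mult(2) by (auto simp: max_ideal_square_def)
  ultimately show "r * f \<in> max_ideal_square X p"
    unfolding max_ideal_square_def mem_Collect_eq
    by (intro conjI exI[of _ m] exI[of _ "\<lambda>j. r * g j"] exI[of _ h])
next
  fix f f' assume f: "f \<in> max_ideal_square X p" and eq: "germ_eq X p f f'"
  have "f' \<in> local_fun X p"
    using local_fun_germ[OF _ eq] f by (auto simp: max_ideal_square_def)
  thus "f' \<in> max_ideal_square X p"
    using f germ_eq_trans[OF germ_eq_sym[OF eq]] unfolding max_ideal_square_def by blast
qed

lemma mult_in_max_ideal_square:
  assumes "p \<in> X" "X \<subseteq> topspace zariski" "g \<in> max_ideal X p" "h \<in> max_ideal X p"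
  shows "g * h \<in> max_ideal_square X p"
proof -
  have "g * h \<in> local_fun X p"
    using assms(3,4) local_fun_add_mult(2) by (auto simp: max_ideal_def)
  moreover have "germ_eq X p (g * h) (\<Sum>j<Suc 0. g * h)"
    using germ_eq_refl[OF assms(1,2)] by simp
  ultimately show ?thesis using assms(3,4) unfolding max_ideal_square_def
    by (intro CollectI conjI exI[of _ "Suc 0"] exI[of _ "\<lambda>_. g"] exI[of _ "\<lambda>_. h"]) auto
qed

lemma quot_dim_residue_field:
  assumes "p \<in> X" "X \<subseteq> topspace zariski"
  shows "quot_dim (local_fun X p) (max_ideal X p) = 1"
proof (rule order.antisym)
  note R = local_fun_subspace[OF assms]
  note sm = local_ideal_subspace[OF assms local_ideal_max_ideal[OF assms]]
  have one: "1 \<in> local_fun X p" using local_fun_const[OF assms, of 1] by (simp add: one_fun_def)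
  have "local_fun X p \<subseteq> fs.span ({1} \<union> max_ideal X p)"
  proof
    fix f assume f: "f \<in> local_fun X p"
    have "f - fscale (f p) 1 \<in> local_fun X p"
      using f one R by (intro fs.subspace_diff fs.subspace_scale)
    hence "f - fscale (f p) 1 \<in> max_ideal X p" by (simp add: max_ideal_def fscale_def)
    hence "fscale (f p) 1 + (f - fscale (f p) 1) \<in> fs.span ({1} \<union> max_ideal X p)"
      by (intro fs.span_add fs.span_scale fs.span_base) auto
    thus "f \<in> fs.span ({1} \<union> max_ideal X p)" by simp
  qed
  from quot_dim_le_card[OF sm _ this] show "quot_dim (local_fun X p) (max_ideal X p) \<le> 1"
    by (simp add: one_enat_def)
  have "indep_mod (max_ideal X p) {1}"
    by (rule indep_modI) (use fs.subspace_0[OF sm] in \<open>auto simp: max_ideal_def fscale_def\<close>)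
  from quot_dim_ge[OF _ this] one show "1 \<le> quot_dim (local_fun X p) (max_ideal X p)"
    by (fastforce simp: one_enat_def)
qed

lemma quot_dim_double_point:
  assumes "p \<in> reg_locus X" "X \<subseteq> topspace zariski"
  shows "quot_dim (local_fun X p) (max_ideal_square X p) = var_dim X + 1"
proof -
  have p: "p \<in> X" using assms(1) by (simp add: reg_locus_def)
  have "quot_dim (local_fun X p) (max_ideal_square X p) =
      quot_dim (max_ideal X p) (max_ideal_square X p) + quot_dim (local_fun X p) (max_ideal X p)"
    using local_ideal_subspace[OF p assms(2) local_ideal_max_ideal_square[OF p assms(2)]]
      local_ideal_subspace[OF p assms(2) local_ideal_max_ideal[OF p assms(2)]]
      local_fun_subspace[OF p assms(2)] max_ideal_square_subset
    by (intro quot_dim_add) (auto simp: max_ideal_def)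
  thus ?thesis using assms(1) quot_dim_residue_field[OF p assms(2)] by (simp add: reg_locus_def)
qed

section \<open>The stalks of points, double points and their unions\<close>

lemma reduced_points_stalk:
  "reduced_points X S q = (if q \<in> S then max_ideal X q else local_fun X q)"
  by (auto simp: reduced_points_def scheme_Union_def reduced_point_def max_ideal_def)

lemma double_points_stalk:
  "double_points X S q = (if q \<in> S then max_ideal_square X q else local_fun X q)"
  by (auto simp: double_points_def scheme_Union_def double_point_def max_ideal_square_def)

text \<open>At \<open>p\<close> the ideal of the union is \<open>\<mm>\<^sub>p \<inter> \<mm>\<^sub>p\<^sup>2 = \<mm>\<^sub>p\<^sup>2\<close>.\<close>

lemma dagger_scheme_stalk:
  assumes "p \<in> S"
  shows "scheme_union (reduced_points X S) (double_point X p) q =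
    (if q = p then max_ideal_square X q else if q \<in> S then max_ideal X q else local_fun X q)"
  using assms max_ideal_square_subset[of X p]
  by (auto simp: scheme_union_def reduced_points_stalk double_point_def max_ideal_def)

lemma scheme_support_eq:
  assumes "S \<subseteq> X" "X \<subseteq> topspace zariski"
    and "\<And>p. p \<in> S \<Longrightarrow> Z p \<subseteq> max_ideal X p"
    and "\<And>p. p \<in> X - S \<Longrightarrow> Z p = local_fun X p"
  shows "scheme_support X Z = S"
proof -
  have "Z p \<noteq> local_fun X p" if "p \<in> S" for p
  proof -
    have "(\<lambda>_. 1) \<in> local_fun X p" "(\<lambda>_. 1) \<notin> max_ideal X p"
      using local_fun_const[of p X 1] that assms(1,2) by (auto simp: max_ideal_def)
    thus ?thesis using assms(3)[OF that] by blast
  qed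
  thus ?thesis using assms(1,4) unfolding scheme_support_def by blast
qed

section \<open>Line bundles in fixed trivialisations\<close>

lemma line_bundleD:
  assumes "line_bundle X L"
  shows "i \<in> idx L \<Longrightarrow> open_in X (patch L i)"
    and "(\<Union>i\<in>idx L. patch L i) = X"
    and "i \<in> idx L \<Longrightarrow> j \<in> idx L \<Longrightarrow> regular_on X (patch L i \<inter> patch L j) (trans_fun L i j)"
    and "i \<in> idx L \<Longrightarrow> q \<in> patch L i \<Longrightarrow> trans_fun L i i q = 1"
    and "i \<in> idx L \<Longrightarrow> j \<in> idx L \<Longrightarrow> k \<in> idx L \<Longrightarrow> q \<in> patch L i \<Longrightarrow> q \<in> patch L j \<Longrightarrow>
      q \<in> patch L k \<Longrightarrow> trans_fun L i j q * trans_fun L j k q = trans_fun L i k q"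
  using assms by (auto simp: line_bundle_def)

lemma line_bundle_topspace:
  assumes "line_bundle X L"
  shows "X \<subseteq> topspace zariski"
  using line_bundleD(2)[OF assms] openin_subset[OF line_bundleD(1)[OF assms]] by fastforce

lemma trans_fun_local:
  assumes "line_bundle X L" "i \<in> idx L" "j \<in> idx L" "p \<in> patch L i" "p \<in> patch L j"
  shows "trans_fun L i j \<in> local_fun X p"
  by (rule local_funI[OF openin_Int[OF line_bundleD(1)[OF assms(1,2)] line_bundleD(1)[OF assms(1,3)]]
      _ line_bundleD(3)[OF assms(1-3)]]) (simp add: assms)

lemma bundle_stalkD:
  assumes "t \<in> bundle_stalk X L p"
  shows "i \<in> idx L \<Longrightarrow> p \<in> patch L i \<Longrightarrow> curry t i \<in> local_fun X p"
    and "i \<in> idx L \<Longrightarrow> j \<in> idx L \<Longrightarrow> p \<in> patch L i \<Longrightarrow> p \<in> patch L j \<Longrightarrow>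
      germ_eq X p (curry t i) (trans_fun L i j * curry t j)"
  using assms unfolding bundle_stalk_def by blast+

lemma bundle_stalk_diff:
  assumes L: "line_bundle X L" and "p \<in> X" and s: "s \<in> bundle_stalk X L p" and t: "t \<in> bundle_stalk X L p"
  shows "s - t \<in> bundle_stalk X L p"
  unfolding bundle_stalk_def mem_Collect_eq
proof (intro conjI ballI impI)
  fix i assume "i \<in> idx L" "p \<in> patch L i"
  thus "curry (s - t) i \<in> local_fun X p"
    using fs.subspace_diff[OF local_fun_subspace[OF assms(2) line_bundle_topspace[OF L]]]
      bundle_stalkD(1)[OF s] bundle_stalkD(1)[OF t] by simp
next
  fix i j assume ij: "i \<in> idx L" "j \<in> idx L" "p \<in> patch L i \<inter> patch L j"
  have "germ_eq X p (curry s i - curry t i)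
      (trans_fun L i j * curry s j - trans_fun L i j * curry t j)"
    using ij by (intro germ_eq_diff bundle_stalkD(2)[OF s] bundle_stalkD(2)[OF t]) auto
  thus "germ_eq X p (curry (s - t) i) (trans_fun L i j * curry (s - t) j)"
    by (simp add: right_diff_distrib)
qed

lemma global_section_in_bundle_stalk:
  assumes L: "line_bundle X L" and s: "s \<in> global_sections X L"
  shows "s \<in> bundle_stalk X L p"
  unfolding bundle_stalk_def mem_Collect_eq
proof (intro conjI ballI impI)
  fix i assume "i \<in> idx L" "p \<in> patch L i"
  thus "curry s i \<in> local_fun X p"
    by (intro local_funI[OF line_bundleD(1)[OF L] _ global_sectionsD(1)[OF s]])
next
  fix i j assume ij: "i \<in> idx L" "j \<in> idx L" "p \<in> patch L i \<inter> patch L j"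
  show "germ_eq X p (curry s i) (trans_fun L i j * curry s j)"
    by (rule germ_eqI[OF openin_Int[OF line_bundleD(1)[OF L ij(1)] line_bundleD(1)[OF L ij(2)]] ij(3)])
       (use global_sectionsD(2)[OF s ij(1,2)] in auto)
qed

text \<open>Membership in an ideal of the local ring can be tested in one trivialisation, because
  transition functions are regular.\<close>

lemma bundle_stalk_ideal_chart:
  assumes L: "line_bundle X L" and I: "local_ideal X p I" and t: "t \<in> bundle_stalk X L p"
    and ij: "i \<in> idx L" "p \<in> patch L i" "j \<in> idx L" "p \<in> patch L j"
    and "curry t i \<in> I"
  shows "curry t j \<in> I"
proof -
  have "trans_fun L j i * curry t i \<in> I"
    by (rule local_ideal_mult[OF I assms(8) trans_fun_local[OF L ij(3,1,4,2)]])
  thus ?thesis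
    by (rule local_ideal_germ[OF I _ germ_eq_sym[OF bundle_stalkD(2)[OF t ij(3,1,4,2)]]])
qed

text \<open>A germ of a function in one trivialisation is the local expression of an element of the
  stalk: the other expressions are forced, and the cocycle condition makes them compatible.\<close>

lemma bundle_stalk_of_germ:
  assumes L: "line_bundle X L" and i: "i \<in> idx L" "p \<in> patch L i" and f: "f \<in> local_fun X p"
  obtains t where "t \<in> bundle_stalk X L p" "germ_eq X p (curry t i) f"
proof
  define t where "t = (\<lambda>(j, q). trans_fun L j i q * f q)"
  have t: "curry t j = trans_fun L j i * f" for j by (auto simp: t_def)
  show "germ_eq X p (curry t i) f"
    by (rule germ_eqI[OF line_bundleD(1)[OF L i(1)] i(2)]) (simp add: t_def line_bundleD(4)[OF L i(1)])
  show "t \<in> bundle_stalk X L p"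
    unfolding bundle_stalk_def mem_Collect_eq
  proof (intro conjI ballI impI)
    fix j assume j: "j \<in> idx L" "p \<in> patch L j"
    show "curry t j \<in> local_fun X p"
      unfolding t by (rule local_fun_add_mult(2)[OF trans_fun_local[OF L j(1) i(1) j(2) i(2)] f])
  next
    fix j k assume jk: "j \<in> idx L" "k \<in> idx L" "p \<in> patch L j \<inter> patch L k"
    show "germ_eq X p (curry t j) (trans_fun L j k * curry t k)"
    proof (rule germ_eqI)
      show "open_in X (patch L j \<inter> patch L k \<inter> patch L i)"
        using jk i by (intro openin_Int line_bundleD(1)[OF L])
      show "p \<in> patch L j \<inter> patch L k \<inter> patch L i" using jk i by blast
      fix q assume "q \<in> patch L j \<inter> patch L k \<inter> patch L i"
      hence "trans_fun L j k q * trans_fun L k i q = trans_fun L j i q"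
        using line_bundleD(5)[OF L jk(1,2) i(1)] by blast
      thus "curry t j q = (trans_fun L j k * curry t k) q"
        by (simp add: t_def mult.assoc[symmetric])
    qed
  qed
qed

text \<open>After a choice of one trivialisation \<open>c p\<close> at each point \<open>p\<close> of the support of \<open>Z\<close>, the
  target of the restriction map becomes the product of the local rings of \<open>Z\<close>.\<close>

lemma independent_conditions_charts:
  assumes L: "line_bundle X L" and Z: "\<And>p. p \<in> X \<Longrightarrow> local_ideal X p (Z p)"
    and c: "\<And>p. p \<in> scheme_support X Z \<Longrightarrow> c p \<in> idx L \<and> p \<in> patch L (c p)"
  shows "independent_conditions X Z L \<longleftrightarrow>
    (\<forall>f. (\<forall>p\<in>scheme_support X Z. f p \<in> local_fun X p) \<longrightarrow>
      (\<exists>s\<in>global_sections X L. \<forall>p\<in>scheme_support X Z. curry s (c p) - f p \<in> Z p))"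
    (is "?ind \<longleftrightarrow> ?charts")
proof
  have PX: "p \<in> X" if "p \<in> scheme_support X Z" for p using that by (simp add: scheme_support_def)
  note XT = line_bundle_topspace[OF L]
  {
    assume ind: ?ind
    show ?charts
    proof (intro allI impI)
      fix f assume f: "\<forall>p\<in>scheme_support X Z. f p \<in> local_fun X p"
      have "\<exists>t. t \<in> bundle_stalk X L p \<and> germ_eq X p (curry t (c p)) (f p)"
        if p: "p \<in> scheme_support X Z" for p
        by (rule bundle_stalk_of_germ[OF L conjunct1[OF c[OF p]] conjunct2[OF c[OF p]] bspec[OF f p]])
           (intro exI conjI)
      then obtain t where t: "\<And>p. p \<in> scheme_support X Z \<Longrightarrow>
          t p \<in> bundle_stalk X L p \<and> germ_eq X p (curry (t p) (c p)) (f p)"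
        by metis
      hence "\<forall>p\<in>scheme_support X Z. t p \<in> bundle_stalk X L p" by blast
      with ind have "\<exists>s\<in>global_sections X L. \<forall>p\<in>scheme_support X Z. \<forall>i\<in>idx L. p \<in> patch L i \<longrightarrow>
          curry s i - curry (t p) i \<in> Z p"
        unfolding independent_conditions_def by (elim allE[of _ t] impE)
      then obtain s where s: "s \<in> global_sections X L"
        "\<And>p. p \<in> scheme_support X Z \<Longrightarrow> curry s (c p) - curry (t p) (c p) \<in> Z p"
        using c by blast
      have "curry s (c p) - f p \<in> Z p" if p: "p \<in> scheme_support X Z" for p
        by (rule local_ideal_germ[OF Z[OF PX[OF p]] s(2)[OF p]])
           (intro germ_eq_diff germ_eq_refl[OF PX[OF p] XT] conjunct2[OF t[OF p]])
      thus "\<exists>s\<in>global_sections X L. \<forall>p\<in>scheme_support X Z. curry s (c p) - f p \<in> Z p"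
        by (intro bexI[OF _ s(1)]) simp
    qed
  next
    assume charts: ?charts
    show ?ind
      unfolding independent_conditions_def
    proof (intro allI impI)
      fix t assume t: "\<forall>p\<in>scheme_support X Z. t p \<in> bundle_stalk X L p"
      hence "\<forall>p\<in>scheme_support X Z. curry (t p) (c p) \<in> local_fun X p"
        by (intro ballI bundle_stalkD(1)[where L = L]) (simp_all add: c)
      with charts have "\<exists>s\<in>global_sections X L. \<forall>p\<in>scheme_support X Z.
          curry s (c p) - curry (t p) (c p) \<in> Z p"
        by (elim allE[of _ "\<lambda>p. curry (t p) (c p)"] impE)
      then obtain s where s: "s \<in> global_sections X L"
        "\<And>p. p \<in> scheme_support X Z \<Longrightarrow> curry s (c p) - curry (t p) (c p) \<in> Z p"
        by blast
      have "curry s i - curry (t p) i \<in> Z p"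
        if p: "p \<in> scheme_support X Z" and i: "i \<in> idx L" "p \<in> patch L i" for p i
      proof -
        have "s - t p \<in> bundle_stalk X L p"
          by (rule bundle_stalk_diff[OF L PX[OF p] global_section_in_bundle_stalk[OF L s(1)] bspec[OF t p]])
        moreover have "curry (s - t p) (c p) \<in> Z p" using s(2)[OF p] by simp
        ultimately have "curry (s - t p) i \<in> Z p"
          by (rule bundle_stalk_ideal_chart[OF L Z[OF PX[OF p]] _
              conjunct1[OF c[OF p]] conjunct2[OF c[OF p]] i])
        thus ?thesis by simp
      qed
      thus "\<exists>s\<in>global_sections X L. \<forall>p\<in>scheme_support X Z. \<forall>i\<in>idx L. p \<in> patch L i \<longrightarrow>
          curry s i - curry (t p) i \<in> Z p"
        by (intro bexI[OF _ s(1)]) simp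
    qed
  }
qed

lemma curry_sum: "curry (\<Sum>x\<in>A. F x) i = (\<Sum>x\<in>A. curry (F x) i)"
  by (simp add: fun_eq_iff sum_fun_apply)

text \<open>By linearity the restriction map is surjective once the summands of its target, one for each
  point of the support, lie in its image.\<close>

lemma independent_conditions_pointwise:
  assumes L: "line_bundle X L" and Z: "\<And>p. p \<in> X \<Longrightarrow> local_ideal X p (Z p)"
    and c: "\<And>p. p \<in> scheme_support X Z \<Longrightarrow> c p \<in> idx L \<and> p \<in> patch L (c p)"
    and fin: "finite (scheme_support X Z)"
    and pt: "\<And>p f. p \<in> scheme_support X Z \<Longrightarrow> f \<in> local_fun X p \<Longrightarrow>
      \<exists>s\<in>global_sections X L. curry s (c p) - f \<in> Z p \<and>
        (\<forall>q\<in>scheme_support X Z - {p}. curry s (c q) \<in> Z q)"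
  shows "independent_conditions X Z L"
proof -
  let ?P = "scheme_support X Z"
  have "\<exists>s\<in>global_sections X L. \<forall>p\<in>?P. curry s (c p) - f p \<in> Z p"
    if f: "\<forall>p\<in>?P. f p \<in> local_fun X p" for f
  proof -
    have "\<forall>p\<in>?P. \<exists>s\<in>global_sections X L. curry s (c p) - f p \<in> Z p \<and>
        (\<forall>q\<in>?P - {p}. curry s (c q) \<in> Z q)"
      using pt f by blast
    then obtain \<sigma> where \<sigma>: "\<And>p. p \<in> ?P \<Longrightarrow> \<sigma> p \<in> global_sections X L"
      "\<And>p. p \<in> ?P \<Longrightarrow> curry (\<sigma> p) (c p) - f p \<in> Z p"
      "\<And>p q. p \<in> ?P \<Longrightarrow> q \<in> ?P \<Longrightarrow> q \<noteq> p \<Longrightarrow> curry (\<sigma> p) (c q) \<in> Z q"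
      unfolding Ball_def Bex_def by (metis Diff_iff singletonD)
    have "(\<Sum>p\<in>?P. \<sigma> p) \<in> global_sections X L"
      using \<sigma>(1) by (intro fs.subspace_sum global_sections_subspace[OF L])
    moreover have "curry (\<Sum>p\<in>?P. \<sigma> p) (c q) - f q \<in> Z q" if q: "q \<in> ?P" for q
    proof -
      have qX: "q \<in> X" using q by (simp add: scheme_support_def)
      have sub: "fs.subspace (Z q)"
        by (rule local_ideal_subspace[OF qX line_bundle_topspace[OF L] Z[OF qX]])
      have "curry (\<Sum>p\<in>?P. \<sigma> p) (c q) - f q =
          (curry (\<sigma> q) (c q) - f q) + (\<Sum>p\<in>?P - {q}. curry (\<sigma> p) (c q))"
        by (simp add: sum.remove[OF fin q] curry_sum)
      also have "\<dots> \<in> Z q"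
        using \<sigma>(2,3) q by (intro fs.subspace_add[OF sub] fs.subspace_sum[OF sub]) auto
      finally show ?thesis .
    qed
    ultimately show ?thesis by blast
  qed
  thus ?thesis using independent_conditions_charts[OF L Z c] by blast
qed

section \<open>Independent conditions and dimensions\<close>

text \<open>Evaluation in the chosen trivialisations maps \<open>H\<^sup>0(L)\<close> to the product of the local rings at
  the support, with \<open>H\<^sup>0(I\<^sub>Z \<otimes> L)\<close> the preimage of the ideal of \<open>Z\<close>. Independence says that it is onto
  modulo that ideal, so \<open>H\<^sup>0(L) / H\<^sup>0(I\<^sub>Z \<otimes> L)\<close> has the dimension of the functions on \<open>Z\<close>. The
  conclusion is a sum because differences lose their meaning when \<open>h0 X L = \<infinity>\<close>.\<close>

lemma independent_conditions_h0:
  fixes X :: "('k::field, 'n::finite) ppoint set" and L :: "('k, 'n, 'i) lbundle"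
  assumes L: "line_bundle X L" and Z: "\<And>p. p \<in> X \<Longrightarrow> local_ideal X p (Z p)"
    and fin: "finite (scheme_support X Z)" and ind: "independent_conditions X Z L"
  shows "h0_ideal X Z L + scheme_length X Z = h0 X L"
proof -
  define P where "P = scheme_support X Z"
  define V where "V = global_sections X L"
  define T where "T = fprod P (local_fun X)"
  define TZ where "TZ = fprod P Z"
  have PX: "p \<in> X" if "p \<in> P" for p using that by (simp add: P_def scheme_support_def)
  note XT = line_bundle_topspace[OF L]
  have "\<forall>p\<in>P. \<exists>j. j \<in> idx L \<and> p \<in> patch L j" using PX line_bundleD(2)[OF L] by blast
  then obtain c where c: "\<And>p. p \<in> P \<Longrightarrow> c p \<in> idx L \<and> p \<in> patch L (c p)" by metis
  define \<phi> where "\<phi> s = (\<lambda>(p, q). if p \<in> P then s (c p, q) else 0)"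
    for s :: "'i \<times> ('k, 'n) ppoint \<Rightarrow> 'k"
  have curry_\<phi>: "curry (\<phi> s) p = (if p \<in> P then curry s (c p) else 0)" for s p
    by (auto simp: \<phi>_def fun_eq_iff)
  have \<phi>0: "\<phi> s (p, q) = 0" if "p \<notin> P" for s p q using that by (simp add: \<phi>_def)
  have lin: "\<phi> (s + t) = \<phi> s + \<phi> t" "\<phi> (fscale a s) = fscale a (\<phi> s)" for s t a
    by (auto simp: \<phi>_def fun_eq_iff fscale_def)
  have sub: "fs.subspace (local_fun X p)" "fs.subspace (Z p)" "Z p \<subseteq> local_fun X p" if "p \<in> P" for p
    using local_fun_subspace[OF PX[OF that] XT] local_ideal_subspace[OF PX[OF that] XT Z] Z PX[OF that]
    unfolding local_ideal_def by blast+
  have sV: "fs.subspace V" unfolding V_def by (rule global_sections_subspace[OF L])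
  have sT: "fs.subspace T" "fs.subspace TZ"
    unfolding T_def TZ_def by (rule fprod_subspace, erule sub)+
  have stalk: "s \<in> bundle_stalk X L p" if "s \<in> V" for s p
    using global_section_in_bundle_stalk[OF L] that by (simp add: V_def)

  have W: "ideal_sections X Z L = {s \<in> V. \<phi> s \<in> TZ}"
  proof (intro equalityI subsetI)
    fix s assume "s \<in> ideal_sections X Z L"
    thus "s \<in> {s \<in> V. \<phi> s \<in> TZ}"
      using c PX \<phi>0 by (auto simp: ideal_sections_def V_def TZ_def fprod_def curry_\<phi>)
  next
    fix s assume s: "s \<in> {s \<in> V. \<phi> s \<in> TZ}"
    have sZ: "curry s (c p) \<in> Z p" if "p \<in> P" for p
      using s that by (auto simp: TZ_def fprod_def curry_\<phi>)
    have "curry s j \<in> Z p" if j: "p \<in> X" "j \<in> idx L" "p \<in> patch L j" for p j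
    proof (cases "p \<in> P")
      case True
      thus ?thesis using bundle_stalk_ideal_chart[OF L Z[OF j(1)] stalk _ _ j(2,3), of s "c p"] c sZ s
        by blast
    next
      case False
      hence "Z p = local_fun X p" using j(1) by (auto simp: P_def scheme_support_def)
      thus ?thesis using bundle_stalkD(1)[OF stalk j(2,3)] s by simp
    qed
    thus "s \<in> ideal_sections X Z L" using s by (auto simp: ideal_sections_def V_def)
  qed
  have "quot_dim V {s \<in> V. \<phi> s \<in> TZ} = quot_dim T TZ"
  proof (rule quot_dim_image[OF lin sV sT(2,1)])
    show "\<phi> ` V \<subseteq> T"
      using bundle_stalkD(1)[OF stalk] c \<phi>0 by (auto simp: T_def fprod_def curry_\<phi>)
    show "TZ \<subseteq> T" unfolding T_def TZ_def fprod_def using sub(3) by blast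
    fix t assume t: "t \<in> T"
    hence "\<forall>p\<in>scheme_support X Z. curry t p \<in> local_fun X p" by (simp add: T_def fprod_def P_def)
    then obtain s where s: "s \<in> V" "\<And>p. p \<in> P \<Longrightarrow> curry s (c p) - curry t p \<in> Z p"
      using ind c independent_conditions_charts[OF L Z, of c] unfolding P_def V_def by metis
    have "curry (t - \<phi> s) p \<in> Z p" if "p \<in> P" for p
      using fs.subspace_neg[OF sub(2)[OF that] s(2)[OF that]] that by (simp add: curry_\<phi>)
    moreover have "t (p, q) = 0" if "p \<notin> P" for p q using t that unfolding T_def fprod_def by blast
    ultimately have "t - \<phi> s \<in> TZ" using \<phi>0 unfolding TZ_def fprod_def by simp
    thus "\<exists>v\<in>V. \<exists>z\<in>TZ. t = \<phi> v + z"
      using s(1) by (intro bexI[of _ s] bexI[of _ "t - \<phi> s"]) auto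
  qed
  also have "quot_dim T TZ = scheme_length X Z"
    unfolding scheme_length_def T_def TZ_def P_def[symmetric]
    by (rule quot_dim_fprod) (use fin sub in \<open>auto simp: P_def\<close>)
  finally have q: "quot_dim V (ideal_sections X Z L) = scheme_length X Z" unfolding W .
  have lin0: "\<phi> 0 = 0" by (auto simp: \<phi>_def fun_eq_iff)
  have sW: "fs.subspace (ideal_sections X Z L)"
    unfolding W using sV sT(2) lin lin0 unfolding fs.subspace_def by auto
  have "h0 X L = h0_ideal X Z L + quot_dim V (ideal_sections X Z L)"
    unfolding h0_def h0_ideal_def V_def[symmetric]
    by (rule quot_dim_add[OF fs.subspace_single_0 sW _ _ sV]) (use fs.subspace_0[OF sW] W in auto)
  thus ?thesis unfolding q by simp
qed

section \<open>Products of sections\<close>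

lemma tensor_simps [simp]:
  "idx (tensor L M) = idx L \<times> idx M"
  "patch (tensor L M) (i, j) = patch L i \<inter> patch M j"
  "trans_fun (tensor L M) (i, j) (i', j') q = trans_fun L i i' q * trans_fun M j j' q"
  by (simp_all add: tensor_def)

lemma line_bundle_tensor:
  assumes L: "line_bundle X L" and M: "line_bundle X M"
  shows "line_bundle X (tensor L M)"
proof -
  have o: "open_in X (patch L i \<inter> patch M j)" if "i \<in> idx L" "j \<in> idx M" for i j
    using that by (intro openin_Int line_bundleD(1)[OF L] line_bundleD(1)[OF M])
  have reg: "regular_on X (patch L i \<inter> patch M j \<inter> (patch L i' \<inter> patch M j'))
      (trans_fun (tensor L M) (i, j) (i', j'))"
    if ij: "i \<in> idx L" "j \<in> idx M" "i' \<in> idx L" "j' \<in> idx M" for i j i' j'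
  proof -
    have "open_in X (patch L i \<inter> patch M j \<inter> (patch L i' \<inter> patch M j'))"
      by (rule openin_Int[OF o[OF ij(1,2)] o[OF ij(3,4)]])
    hence "regular_on X (patch L i \<inter> patch M j \<inter> (patch L i' \<inter> patch M j'))
        (trans_fun L i i' * trans_fun M j j')"
      using ij by (intro regular_on_mult regular_on_subset[OF line_bundleD(3)[OF L]]
          regular_on_subset[OF line_bundleD(3)[OF M]]) auto
    thus ?thesis by (rule regular_on_cong) simp
  qed
  have coc: "trans_fun (tensor L M) x y q * trans_fun (tensor L M) y z q = trans_fun (tensor L M) x z q"
    if "x \<in> idx (tensor L M)" "y \<in> idx (tensor L M)" "z \<in> idx (tensor L M)"
      "q \<in> patch (tensor L M) x \<inter> patch (tensor L M) y \<inter> patch (tensor L M) z" for x y z q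
  proof -
    obtain i j i' j' i'' j'' where x: "x = (i, j)" "y = (i', j')" "z = (i'', j'')"
      by (cases x; cases y; cases z)
    have "trans_fun L i i' q * trans_fun L i' i'' q = trans_fun L i i'' q"
      "trans_fun M j j' q * trans_fun M j' j'' q = trans_fun M j j'' q"
      using that x by (auto intro!: line_bundleD(5)[OF L] line_bundleD(5)[OF M])
    thus ?thesis unfolding x tensor_simps by (metis mult.assoc mult.left_commute)
  qed
  have cover: "(\<Union>x\<in>idx (tensor L M). patch (tensor L M) x) = X"
    using line_bundleD(2)[OF L] line_bundleD(2)[OF M] by (fastforce simp: tensor_def)
  show ?thesis
    unfolding line_bundle_def
    using o reg coc cover line_bundleD(4)[OF L] line_bundleD(4)[OF M]
    by (intro conjI ballI) auto
qed

definition section_mult :: "('i \<times> 'p \<Rightarrow> 'k::field) \<Rightarrow> ('j \<times> 'p \<Rightarrow> 'k) \<Rightarrow> ('i \<times> 'j) \<times> 'p \<Rightarrow> 'k" where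
  "section_mult s t = (\<lambda>((i, j), q). s (i, q) * t (j, q))"

lemma curry_section_mult: "curry (section_mult s t) (i, j) = curry s i * curry t j"
  by (auto simp: section_mult_def)

lemma section_mult_global:
  assumes L: "line_bundle X L" and M: "line_bundle X M"
    and s: "s \<in> global_sections X L" and t: "t \<in> global_sections X M"
  shows "section_mult s t \<in> global_sections X (tensor L M)"
proof (rule global_sectionsI)
  fix x assume "x \<in> idx (tensor L M)"
  then obtain i j where x: "x = (i, j)" "i \<in> idx L" "j \<in> idx M" by auto
  have "open_in X (patch L i \<inter> patch M j)"
    using x by (intro openin_Int line_bundleD(1)[OF L] line_bundleD(1)[OF M])
  thus "regular_on X (patch (tensor L M) x) (curry (section_mult s t) x)"
    unfolding x curry_section_mult tensor_simps using x
    by (intro regular_on_mult regular_on_subset[OF global_sectionsD(1)[OF s]]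
        regular_on_subset[OF global_sectionsD(1)[OF t]]) auto
next
  fix x y q assume xy: "x \<in> idx (tensor L M)" "y \<in> idx (tensor L M)"
    "q \<in> patch (tensor L M) x" "q \<in> patch (tensor L M) y"
  obtain i j i' j' where x: "x = (i, j)" "y = (i', j')" by (cases x; cases y)
  have "s (i, q) = trans_fun L i i' q * s (i', q)" "t (j, q) = trans_fun M j j' q * t (j', q)"
    using xy x by (auto intro!: global_sectionsD(2)[OF s] global_sectionsD(2)[OF t])
  thus "section_mult s t (x, q) = trans_fun (tensor L M) x y q * section_mult s t (y, q)"
    unfolding x by (simp add: section_mult_def)
next
  fix x q assume "x \<notin> idx (tensor L M) \<or> q \<notin> patch (tensor L M) x"
  thus "section_mult s t (x, q) = 0"
    using global_sectionsD(3)[OF s] global_sectionsD(3)[OF t]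
    by (cases x) (auto simp: section_mult_def)
qed

text \<open>If \<open>b = 1 + e\<close> with \<open>e \<in> \<mm>\<^sub>p\<close>, then \<open>2 - b = 1 - e\<close> inverts \<open>b\<close> modulo \<open>\<mm>\<^sub>p\<^sup>2\<close>. So a function with
  expansion \<open>f * (2 - b)\<close> modulo \<open>\<mm>\<^sub>p\<^sup>2\<close> becomes \<open>f\<close> after multiplication by \<open>b\<close>. The error
  \<open>a * b - f\<close> equals \<open>b * (a - f * (2 - b)) - f * e\<^sup>2\<close>.\<close>

lemma first_order_division:
  assumes p: "p \<in> X" "X \<subseteq> topspace zariski" and f: "f \<in> local_fun X p"
    and b: "b \<in> local_fun X p" "b - 1 \<in> max_ideal X p"
    and a: "a - f * (2 - b) \<in> max_ideal_square X p"
  shows "a * b - f \<in> max_ideal_square X p"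
proof -
  note I = local_ideal_max_ideal_square[OF p]
  note sub = local_ideal_subspace[OF p I]
  have "f * ((b - 1) * (b - 1)) \<in> max_ideal_square X p"
    by (rule local_ideal_mult[OF I mult_in_max_ideal_square[OF p b(2,2)] f])
  moreover have "b * (a - f * (2 - b)) \<in> max_ideal_square X p"
    by (rule local_ideal_mult[OF I a b(1)])
  ultimately have "b * (a - f * (2 - b)) - f * ((b - 1) * (b - 1)) \<in> max_ideal_square X p"
    by (rule fs.subspace_diff[OF sub, rotated])
  moreover have "b * (a - f * (2 - b)) - f * ((b - 1) * (b - 1)) = a * b - f"
    by (simp add: algebra_simps)
  ultimately show ?thesis by simp
qed

text \<open>The multiplication map of sections does the work: a section of \<open>M\<close> that is \<open>1\<close> at \<open>p\<close> and \<open>0\<close>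
  at the other points of \<open>S\<close> is a unit at \<open>p\<close>, and elsewhere it raises the order of vanishing of the
  section of \<open>L\<close> from one to two.\<close>

lemma independent_conditions_tensor:
  fixes X :: "('k::field, 'n::finite) ppoint set"
  assumes L: "line_bundle X L" and M: "line_bundle X M"
    and S: "S \<subseteq> X" "finite S"
    and dag: "dagger X L S" and ind: "independent_conditions X (reduced_points X S) M"
  shows "independent_conditions X (double_points X S) (tensor L M)"
proof -
  note XT = line_bundle_topspace[OF L]
  note sq_ideal = local_ideal_max_ideal_square[OF _ XT]
    and max = local_ideal_max_ideal[OF _ XT] and loc = local_ideal_local_fun[OF _ XT]
  have "\<forall>p\<in>S. \<exists>i. i \<in> idx L \<and> p \<in> patch L i" using S line_bundleD(2)[OF L] by blast
  then obtain c where c: "\<And>p. p \<in> S \<Longrightarrow> c p \<in> idx L \<and> p \<in> patch L (c p)" by metis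
  have "\<forall>p\<in>S. \<exists>j. j \<in> idx M \<and> p \<in> patch M j" using S line_bundleD(2)[OF M] by blast
  then obtain d where d: "\<And>p. p \<in> S \<Longrightarrow> d p \<in> idx M \<and> p \<in> patch M (d p)" by metis
  have sup2: "scheme_support X (double_points X S) = S"
    by (rule scheme_support_eq[OF S(1) XT]) (simp_all add: double_points_stalk max_ideal_square_subset)
  have sup1: "scheme_support X (reduced_points X S) = S"
    by (rule scheme_support_eq[OF S(1) XT]) (simp_all add: reduced_points_stalk)
  have supd: "scheme_support X (scheme_union (reduced_points X S) (double_point X p)) = S"
    if "p \<in> S" for p
    by (rule scheme_support_eq[OF S(1) XT])
       (use that in \<open>auto simp: dagger_scheme_stalk max_ideal_square_subset[THEN subsetD]\<close>)
  have zero: "0 \<in> local_fun X q" if "q \<in> S" for q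
    using loc[of q] S that by (auto simp: local_ideal_def)

  \<comment> \<open>The two hypotheses on sections, read in the trivialisations \<open>d\<close> and \<open>c\<close>.\<close>
  have secM: "\<exists>s\<in>global_sections X M. \<forall>q\<in>S. curry s (d q) - g q \<in> max_ideal X q"
    if g: "\<And>q. q \<in> S \<Longrightarrow> g q \<in> local_fun X q" for g
  proof -
    have "local_ideal X q (reduced_points X S q)" if "q \<in> X" for q
      using max loc that by (simp add: reduced_points_stalk)
    hence "\<forall>f. (\<forall>q\<in>S. f q \<in> local_fun X q) \<longrightarrow>
        (\<exists>s\<in>global_sections X M. \<forall>q\<in>S. curry s (d q) - f q \<in> reduced_points X S q)"
      using independent_conditions_charts[OF M, of "reduced_points X S" d] ind d unfolding sup1
      by simp
    hence "\<exists>s\<in>global_sections X M. \<forall>q\<in>S. curry s (d q) - g q \<in> reduced_points X S q"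
      by (elim allE[of _ g] impE) (simp add: g)
    thus ?thesis by (simp add: reduced_points_stalk)
  qed
  have secL: "\<exists>s\<in>global_sections X L. curry s (c p) - g p \<in> max_ideal_square X p \<and>
      (\<forall>q\<in>S - {p}. curry s (c q) - g q \<in> max_ideal X q)"
    if p: "p \<in> S" and g: "\<And>q. q \<in> S \<Longrightarrow> g q \<in> local_fun X q" for p g
  proof -
    let ?Z = "scheme_union (reduced_points X S) (double_point X p)"
    have "local_ideal X q (?Z q)" if "q \<in> X" for q
      using sq_ideal max loc that by (auto simp: dagger_scheme_stalk[OF p])
    moreover have "independent_conditions X ?Z L" using dag p by (simp add: dagger_def)
    ultimately have "\<forall>f. (\<forall>q\<in>S. f q \<in> local_fun X q) \<longrightarrow>
        (\<exists>s\<in>global_sections X L. \<forall>q\<in>S. curry s (c q) - f q \<in> ?Z q)"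
      using independent_conditions_charts[OF L, of ?Z c] c unfolding supd[OF p] by simp
    hence "\<exists>s\<in>global_sections X L. \<forall>q\<in>S. curry s (c q) - g q \<in> ?Z q"
      by (elim allE[of _ g] impE) (simp add: g)
    then obtain s where s: "s \<in> global_sections X L" "\<forall>q\<in>S. curry s (c q) - g q \<in> ?Z q" ..
    have "curry s (c p) - g p \<in> max_ideal_square X p"
      using bspec[OF s(2) p] by (simp add: dagger_scheme_stalk[OF p])
    moreover have "curry s (c q) - g q \<in> max_ideal X q" if "q \<in> S - {p}" for q
      using bspec[OF s(2), of q] that by (simp add: dagger_scheme_stalk[OF p])
    ultimately show ?thesis using s(1) by (intro bexI[of _ s]) simp_all
  qed

  show ?thesis
  proof (rule independent_conditions_pointwise[where c = "\<lambda>p. (c p, d p)"])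
    show "line_bundle X (tensor L M)" by (rule line_bundle_tensor[OF L M])
    show "local_ideal X p (double_points X S p)" if "p \<in> X" for p
      using sq_ideal loc that by (simp add: double_points_stalk)
    show "(c p, d p) \<in> idx (tensor L M) \<and> p \<in> patch (tensor L M) (c p, d p)"
      if "p \<in> scheme_support X (double_points X S)" for p
      using c d that by (simp add: sup2)
    show "finite (scheme_support X (double_points X S))" using S by (simp add: sup2)
  next
    fix p f assume "p \<in> scheme_support X (double_points X S)" and f: "f \<in> local_fun X p"
    hence p: "p \<in> S" by (simp add: sup2)
    hence pX: "p \<in> X" using S by blast
    note R = local_fun_subspace[OF pX XT]
    have one: "1 \<in> local_fun X p" using local_fun_const[OF pX XT, of 1] by (simp add: one_fun_def)
    obtain s\<^sub>2 where s\<^sub>2: "s\<^sub>2 \<in> global_sections X M"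
      "\<forall>q\<in>S. curry s\<^sub>2 (d q) - (if q = p then 1 else 0) \<in> max_ideal X q"
      by (rule bexE[OF secM[of "\<lambda>q. if q = p then 1 else 0"]]) (use one zero in simp)
    define b where "b = curry s\<^sub>2 (d p)"
    have b: "b \<in> local_fun X p"
      unfolding b_def
      by (rule bundle_stalkD(1)[OF global_section_in_bundle_stalk[OF M s\<^sub>2(1)]])
         (simp_all add: d[OF p])
    \<comment> \<open>The expansion asked of the first factor is corrected in advance for the second one.\<close>
    have "1 + (1 - b) \<in> local_fun X p"
      using one b by (intro fs.subspace_add[OF R] fs.subspace_diff[OF R])
    hence "f * (1 + (1 - b)) \<in> local_fun X p" by (rule local_fun_add_mult(2)[OF f])
    moreover have "1 + (1 - b) = 2 - b" by simp
    ultimately have "f * (2 - b) \<in> local_fun X p" by simp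
    hence "\<exists>s\<in>global_sections X L. curry s (c p) - f * (2 - b) \<in> max_ideal_square X p \<and>
        (\<forall>q\<in>S - {p}. curry s (c q) \<in> max_ideal X q)"
      using secL[OF p, of "\<lambda>q. if q = p then f * (2 - b) else 0"] zero by simp
    then obtain s\<^sub>1 where s\<^sub>1: "s\<^sub>1 \<in> global_sections X L"
      "curry s\<^sub>1 (c p) - f * (2 - b) \<in> max_ideal_square X p"
      "\<And>q. q \<in> S - {p} \<Longrightarrow> curry s\<^sub>1 (c q) \<in> max_ideal X q"
      by blast
    have "curry s\<^sub>1 (c p) * b - f \<in> max_ideal_square X p"
      by (rule first_order_division[OF pX XT f b _ s\<^sub>1(2)]) (use bspec[OF s\<^sub>2(2) p] in \<open>simp add: b_def\<close>)
    moreover have "curry s\<^sub>1 (c q) * curry s\<^sub>2 (d q) \<in> max_ideal_square X q" if "q \<in> S - {p}" for q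
      by (rule mult_in_max_ideal_square[OF _ XT s\<^sub>1(3)[OF that]])
         (use that S(1) bspec[OF s\<^sub>2(2), of q] in auto)
    ultimately show "\<exists>s\<in>global_sections X (tensor L M).
        curry s (c p, d p) - f \<in> double_points X S p \<and>
        (\<forall>q\<in>scheme_support X (double_points X S) - {p}. curry s (c q, d q) \<in> double_points X S q)"
      using p section_mult_global[OF L M s\<^sub>1(1) s\<^sub>2(1)] unfolding sup2
      by (intro bexI[of _ "section_mult s\<^sub>1 s\<^sub>2"])
         (auto simp: curry_section_mult double_points_stalk b_def)
  qed
qed

theorem theorem3p5:
  fixes X :: "('k::{alg_closed_field, field_char_0}, 'n::finite) ppoint set"
    and L\<^sub>1 :: "('k, 'n, 'i) lbundle" and L\<^sub>2 :: "('k, 'n, 'j) lbundle"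
    and S :: "('k, 'n) ppoint set" and n r :: nat
  assumes "projective_variety X" and "var_dim X = enat n"
    and "line_bundle X L\<^sub>1" and "line_bundle X L\<^sub>2"
    and "S \<subseteq> reg_locus X" and "finite S" and "card S = r"
    and "dagger X L\<^sub>1 S"
    and "independent_conditions X (reduced_points X S) L\<^sub>2"
  shows "independent_conditions X (double_points X S) (tensor L\<^sub>1 L\<^sub>2) \<and>
    h0_ideal X (double_points X S) (tensor L\<^sub>1 L\<^sub>2) + enat ((n + 1) * r) = h0 X (tensor L\<^sub>1 L\<^sub>2) \<and>
    S \<notin> terracini_locus r X (tensor L\<^sub>1 L\<^sub>2)"
proof -
  let ?Z = "double_points X S" and ?L = "tensor L\<^sub>1 L\<^sub>2"
  note XT = line_bundle_topspace[OF assms(3)]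
  have SX: "S \<subseteq> X" using assms(5) by (auto simp: reg_locus_def)
  have ind: "independent_conditions X ?Z ?L"
    by (rule independent_conditions_tensor[OF assms(3,4) SX assms(6,8,9)])
  have supp: "scheme_support X ?Z = S"
    by (rule scheme_support_eq[OF SX XT]) (simp_all add: double_points_stalk max_ideal_square_subset)
  have "scheme_length X ?Z = (\<Sum>p\<in>S. quot_dim (local_fun X p) (max_ideal_square X p))"
    unfolding scheme_length_def supp by (simp add: double_points_stalk)
  also have "\<dots> = (\<Sum>p\<in>S. enat (n + 1))"
    using quot_dim_double_point[OF _ XT] assms(2,5) by (intro sum.cong) (auto simp: one_enat_def)
  also have "\<dots> = enat ((n + 1) * r)"
    using assms(7) by (simp add: of_nat_eq_enat mult.commute)
  finally have len: "scheme_length X ?Z = enat ((n + 1) * r)" .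
  have "local_ideal X p (?Z p)" if "p \<in> X" for p
    using local_ideal_max_ideal_square[OF that XT] local_ideal_local_fun[OF that XT]
    by (simp add: double_points_stalk)
  hence h0: "h0_ideal X ?Z ?L + enat ((n + 1) * r) = h0 X ?L"
    using independent_conditions_h0[OF line_bundle_tensor[OF assms(3,4)] _ _ ind] assms(6)
    by (simp add: supp len)
  have "(var_dim X + 1) * enat r = enat ((n + 1) * r)"
    using assms(2) by (simp add: one_enat_def)
  hence "S \<notin> terracini_locus r X ?L" using h0 by (simp add: terracini_locus_def)
  thus ?thesis using ind h0 by blast
qed

end
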